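(* On each non-coarsest level $\ell=1,\dots,L$ of the multigrid hierarchy described in the context, let the smoother iteration matrix be \[ G_\ell = p_\ell(B_\ell A_\ell), \] where $B_\ell$ is a symmetric positive definite matrix scaled such that $\rho(B_\ell A_\ell)\le 1$, and $p_\ell$ is a real polynomial (possibly different on each level) satisfying $p_\ell(0)=1$ and $|p_\ell(x)|<1$ for $0<x\le 1$. Let \[ \gamma_\ell = \sup_{0<\lambda\le 1}\frac{\lambda\,p_\ell(\lambda)^2}{1-p_\ell(\lambda)^2}. \] Then the V-cycle contraction factor satisfies \[ \|E_L\|_{A_L}^2 \le \max_{1\le \ell\le L} \frac{C_\ell}{C_\ell+\gamma_\ell^{-1}}, \] where $C_\ell$ is the approximation property constant of level $\ell$ defined in the context.
   Context: Multigrid hierarchy. Levels are indexed $\ell=0,1,\dots,L$ with $L\ge 1$; $\ell=L$ is the finest and $\ell=0$ the coarsest. All matrices are real and $*$ denotes transpose. $A_L$ is a symmetric positive definite (SPD) $n_L\times n_L$ matrix. For $\ell=1,\dots,L$ the prolongation $P_\ell$ is an injective $n_\ell\times n_{\ell-1}$ matrix with $n_{\ell-1}<n_\ell$, and the coarse operators are the Galerkin operators $A_{\ell-1}=P_\ell^*A_\ell P_\ell$. Given smoother iteration matrices $G_\ell$ ($1\le\ell\le L$), the half V-cycle ("coarse-to-fine") is defined recursively: $M_0=A_0^{-1}$, and for $\ell\ge 1$ the matrix $M_\ell$ is determined by \[ E_\ell = I-M_\ell A_\ell = G_\ell K_\ell,\qquad K_\ell = I-P_\ell M_{\ell-1}P_\ell^*A_\ell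 . \] For an SPD matrix $S$, $\|v\|_S=(v^*Sv)^{1/2}$, and $\|T\|_S=\sup_{v\ne0}\|Tv\|_S/\|v\|_S$ for a square matrix $T$. The number $\|E_L\|_{A_L}^2$ is called the V-cycle contraction factor (it is the energy-norm contraction factor of the symmetric V-cycle). $\rho$ denotes the spectral radius. The approximation property constant of level $\ell\ge1$, for the SPD matrix $B_\ell$, is \[ C_\ell = \sup_{\|f\|_{B_\ell}\le 1}\big\|(A_\ell^{-1}-P_\ell A_{\ell-1}^{-1}P_\ell^* )f\big\|_{A_\ell}^2 . \] Convention: $\gamma_\ell^{-1}=0$ if $\gamma_\ell=+\infty$. *)

theory Defs
  imports
    "Jordan_Normal_Form.Spectral_Radius"
    "Jordan_Normal_Form.Gauss_Jordan_Elimination"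
    "HOL-Library.Extended_Real"
begin

definition spd :: "nat \<Rightarrow> real mat \<Rightarrow> bool" where
  "spd n S \<longleftrightarrow> S \<in> carrier_mat n n \<and> transpose_mat S = S \<and>
     (\<forall>v \<in> carrier_vec n. v \<noteq> 0\<^sub>v n \<longrightarrow> 0 < v \<bullet> (S *\<^sub>v v))"

definition energy_norm :: "real mat \<Rightarrow> real vec \<Rightarrow> real" where
  "energy_norm S v = sqrt (v \<bullet> (S *\<^sub>v v))"

definition energy_opnorm :: "real mat \<Rightarrow> real mat \<Rightarrow> real" where
  "energy_opnorm S T =
     (SUP v \<in> carrier_vec (dim_row S) - {0\<^sub>v (dim_row S)}. energy_norm S (T *\<^sub>v v) / energy_norm S v)"

text \<open>Only meaningful for invertible arguments; \<^const>\<open>mat_inverse\<close> returns \<^const>\<open>None\<close> otherwise.\<close>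
definition inv_mat :: "real mat \<Rightarrow> real mat" where
  "inv_mat A = the (mat_inverse A)"

text \<open>The matrix polynomial \<open>p(X) = \<Sum>k. coeff p k \<cdot> X\<^sup>k\<close> of a square matrix, with the sum
  written out entrywise because matrices of varying dimension do not form an additive monoid type.\<close>
definition poly_mat :: "real poly \<Rightarrow> real mat \<Rightarrow> real mat" where
  "poly_mat p X = mat (dim_row X) (dim_row X)
     (\<lambda>(i, j). \<Sum>k\<le>degree p. coeff p k * (X ^\<^sub>m k) $$ (i, j))"

definition real_spectral_radius :: "real mat \<Rightarrow> real" where
  "real_spectral_radius X = spectral_radius (map_mat complex_of_real X)"

text \<open>\<open>P l\<close> maps level \<open>l - 1\<close> to level \<open>l\<close>; only levels \<open>l \<le> L\<close> (for \<open>P\<close>: \<open>1 \<le> l \<le> L\<close>) are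
  constrained.  Positive definiteness of the coarse operators follows from the Galerkin relation.\<close>
definition multigrid_hierarchy ::
    "nat \<Rightarrow> (nat \<Rightarrow> nat) \<Rightarrow> (nat \<Rightarrow> real mat) \<Rightarrow> (nat \<Rightarrow> real mat) \<Rightarrow> bool" where
  "multigrid_hierarchy L n A P \<longleftrightarrow>
     1 \<le> L \<and> spd (n L) (A L) \<and>
     (\<forall>l \<in> {1..L}.
        n (l - 1) < n l \<and>
        P l \<in> carrier_mat (n l) (n (l - 1)) \<and>
        inj_on (\<lambda>v. P l *\<^sub>v v) (carrier_vec (n (l - 1))) \<and>
        A (l - 1) = transpose_mat (P l) * A l * P l)"

text \<open>The half V-cycle matrices \<open>M l\<close> for smoother iteration matrices \<open>G l\<close>.  Since \<open>A l\<close> is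
  invertible, the error propagation equation \<open>I - M l * A l = G l * K l\<close> determines \<open>M l\<close> uniquely.\<close>
definition half_vcycle ::
    "nat \<Rightarrow> (nat \<Rightarrow> nat) \<Rightarrow> (nat \<Rightarrow> real mat) \<Rightarrow> (nat \<Rightarrow> real mat) \<Rightarrow> (nat \<Rightarrow> real mat)
       \<Rightarrow> (nat \<Rightarrow> real mat) \<Rightarrow> bool" where
  "half_vcycle L n A P G M \<longleftrightarrow>
     M 0 = inv_mat (A 0) \<and>
     (\<forall>l \<in> {1..L}.
        M l \<in> carrier_mat (n l) (n l) \<and>
        1\<^sub>m (n l) - M l * A l
          = G l * (1\<^sub>m (n l) - P l * M (l - 1) * transpose_mat (P l) * A l))"

definition approx_const :: "real mat \<Rightarrow> real mat \<Rightarrow> real mat \<Rightarrow> real mat \<Rightarrow> real" where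
  "approx_const A Ac P B =
     (SUP f \<in> {f \<in> carrier_vec (dim_row A). energy_norm B f \<le> 1}.
        (energy_norm A ((inv_mat A - P * inv_mat Ac * transpose_mat P) *\<^sub>v f))\<^sup>2)"

text \<open>Extended-real valued, since the supremum may be \<open>\<infinity>\<close>; on \<^typ>\<open>ereal\<close>, \<open>inverse \<infinity> = 0\<close>.\<close>
definition smoothing_gamma :: "real poly \<Rightarrow> ereal" where
  "smoothing_gamma p =
     (SUP x \<in> {0<..1}. ereal (x * (poly p x)\<^sup>2 / (1 - (poly p x)\<^sup>2)))"

end

theory Submission
  imports Defs
begin

text \<open>Write \<open>\<langle>u, v\<rangle>\<close> for the energy inner product of a level, \<open>X = B A\<close>, \<open>G = p(X)\<close>, and \<open>\<pi>\<close> for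
  the energy-orthogonal projector onto the range of \<open>P\<close>.  Let \<open>d\<close> be the claimed maximum; the
  bound \<open>\<parallel>E v\<parallel>\<^sup>2 \<le> d \<parallel>v\<parallel>\<^sup>2\<close> propagates from each level to the next finer one, and it is trivial on
  the coarsest level, where the solve is exact.

  On one level put \<open>u = E v = G k\<close> with \<open>k = K v\<close>, and \<open>s = G u\<close>.  Since \<open>X\<close> is self-adjoint in the
  energy inner product, so is \<open>G\<close>, and \<open>\<parallel>u\<parallel>\<^sup>2 = \<langle>G k, u\<rangle> = \<langle>k, s\<rangle>\<close>.  The correction \<open>K\<close> keeps the
  part \<open>(I - \<pi>) v\<close> and applies the error propagation of the coarser level to \<open>\<pi> v\<close>, so Cauchy-Schwarz
  on the orthogonal sum gives
  \<open>\<parallel>u\<parallel>\<^sup>4 \<le> \<parallel>v\<parallel>\<^sup>2 (\<parallel>(I - \<pi>) s\<parallel>\<^sup>2 + d \<parallel>\<pi> s\<parallel>\<^sup>2) = \<parallel>v\<parallel>\<^sup>2 ((1 - d) \<parallel>(I - \<pi>) s\<parallel>\<^sup>2 + d \<parallel>s\<parallel>\<^sup>2)\<close>.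
  It remains to see \<open>(1 - d) \<parallel>(I - \<pi>) s\<parallel>\<^sup>2 \<le> d (\<parallel>u\<parallel>\<^sup>2 - \<parallel>s\<parallel>\<^sup>2)\<close>.  The approximation property bounds
  \<open>\<parallel>(I - \<pi>) s\<parallel>\<^sup>2\<close> by \<open>C \<langle>s, X s\<rangle>\<close> (\<open>approximation_property\<close>), and with \<open>s = p(X) u\<close> the resulting
  inequality compares the values at \<open>u\<close> of two polynomials in \<open>X\<close>.  It therefore follows from the
  scalar inequality \<open>(1 - d) C x p(x)\<^sup>2 \<le> d (1 - p(x)\<^sup>2)\<close> on the spectrum of \<open>X\<close>, which lies in the
  interval from \<open>0\<close> to \<open>1\<close> (\<open>polynomial_smoothing\<close>); and \<open>d \<ge> C / (C + 1 / \<gamma>)\<close> is exactly what the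
  scalar inequality needs (\<open>contraction_term\<close>).  The step is \<open>vcycle_level\<close>.

  The passage from scalars to matrices is \<open>poly_act_mono\<close>.  It rests on a spectral measure attached
  to each single vector, built from its minimal annihilating polynomial, rather than on a
  diagonalisation of \<open>X\<close>.\<close>

section \<open>Wide matrices and inverses of positive definite matrices\<close>

text \<open>Padding with zero rows gives a singular square matrix.  The lemma yields annihilating polynomials
  below and vectors in the kernel of the restriction \<open>P\<^sup>T\<close>.\<close>

lemma wide_matrix_kernel:
  fixes D :: "'a::field mat"
  assumes D: "D \<in> carrier_mat m n" and mn: "m < n"
  obtains c where "c \<in> carrier_vec n" "c \<noteq> 0\<^sub>v n" "D *\<^sub>v c = 0\<^sub>v m"
proof -
  define S where "S = mat\<^sub>r n n (\<lambda>i. if i = m then 0\<^sub>v n else if i < m then row D i else 0\<^sub>v n)"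
  have S: "S \<in> carrier_mat n n" unfolding S_def by auto
  have "det S = 0"
    unfolding S_def using D by (intro det_row_0[OF mn]) auto
  with det_0_iff_vec_prod_zero_field[OF S] obtain c
    where c: "c \<in> carrier_vec n" "c \<noteq> 0\<^sub>v n" "S *\<^sub>v c = 0\<^sub>v n" by auto
  have "D *\<^sub>v c = 0\<^sub>v m"
  proof (rule eq_vecI)
    fix i assume "i < dim_vec (0\<^sub>v m :: 'a vec)"
    hence i: "i < m" by simp
    hence "row S i = row D i" using mn D unfolding S_def by (intro eq_vecI) auto
    moreover have "(S *\<^sub>v c) $ i = 0" using c(3) i mn by simp
    ultimately show "(D *\<^sub>v c) $ i = 0\<^sub>v m $ i" using i mn D S by simp
  qed (use D in auto)
  thus ?thesis using that c by blast
qed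

lemma spd_carrier: "spd n S \<Longrightarrow> S \<in> carrier_mat n n"
  by (simp add: spd_def)

lemma inv_mat_spd:
  assumes "spd n S"
  shows "inv_mat S \<in> carrier_mat n n" "S * inv_mat S = 1\<^sub>m n" "inv_mat S * S = 1\<^sub>m n"
proof -
  note S = spd_carrier[OF assms]
  have "det S \<noteq> 0"
  proof
    assume "det S = 0"
    with det_0_iff_vec_prod_zero_field[OF S] obtain v
      where v: "v \<in> carrier_vec n" "v \<noteq> 0\<^sub>v n" "S *\<^sub>v v = 0\<^sub>v n" by auto
    with assms have "0 < v \<bullet> 0\<^sub>v n" unfolding spd_def by metis
    thus False using v by simp
  qed
  hence "mat_inverse S \<noteq> None"
    using mat_inverse(1)[OF S, where b = "()"] det_non_zero_imp_unit[OF S, where b = "()"] by blast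
  then obtain T where T: "mat_inverse S = Some T" by auto
  from mat_inverse(2)[OF S T]
  show "inv_mat S \<in> carrier_mat n n" "S * inv_mat S = 1\<^sub>m n" "inv_mat S * S = 1\<^sub>m n"
    unfolding inv_mat_def T by auto
qed

lemma mult_mat_zero_vec [simp]: "T \<in> carrier_mat m n \<Longrightarrow> T *\<^sub>v 0\<^sub>v n = (0\<^sub>v m :: real vec)"
  by (intro eq_vecI) auto

section \<open>The energy inner product\<close>

definition energy_inner :: "real mat \<Rightarrow> real vec \<Rightarrow> real vec \<Rightarrow> real" where
  "energy_inner S u v = u \<bullet> (S *\<^sub>v v)"

context
  fixes n :: nat and S :: "real mat"
  assumes S: "S \<in> carrier_mat n n"
begin

lemma energy_inner_add_left:
  "u \<in> carrier_vec n \<Longrightarrow> v \<in> carrier_vec n \<Longrightarrow> w \<in> carrier_vec n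
    \<Longrightarrow> energy_inner S (u + v) w = energy_inner S u w + energy_inner S v w"
  unfolding energy_inner_def using S by (intro add_scalar_prod_distrib) auto

lemma energy_inner_add_right:
  "u \<in> carrier_vec n \<Longrightarrow> v \<in> carrier_vec n \<Longrightarrow> w \<in> carrier_vec n
    \<Longrightarrow> energy_inner S u (v + w) = energy_inner S u v + energy_inner S u w"
  unfolding energy_inner_def using S
  by (simp add: mult_add_distrib_mat_vec[OF S] scalar_prod_add_distrib[of _ n])

lemma energy_inner_smult_left:
  "u \<in> carrier_vec n \<Longrightarrow> v \<in> carrier_vec n
    \<Longrightarrow> energy_inner S (c \<cdot>\<^sub>v u) v = c * energy_inner S u v"
  unfolding energy_inner_def using S by (intro smult_scalar_prod_distrib) auto

lemma energy_inner_smult_right: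
  "u \<in> carrier_vec n \<Longrightarrow> v \<in> carrier_vec n
    \<Longrightarrow> energy_inner S u (c \<cdot>\<^sub>v v) = c * energy_inner S u v"
  unfolding energy_inner_def using S by (simp add: mult_mat_vec[OF S])

lemma energy_inner_zero_right: "u \<in> carrier_vec n \<Longrightarrow> energy_inner S u (0\<^sub>v n) = 0"
  by (simp add: energy_inner_def mult_mat_zero_vec[OF S])

end

lemma energy_inner_adjoint:
  fixes T :: "real mat"
  assumes T: "T \<in> carrier_mat n m" and "S \<in> carrier_mat n n"
    and "u \<in> carrier_vec m" "w \<in> carrier_vec n"
  shows "energy_inner S (T *\<^sub>v u) w = u \<bullet> (transpose_mat T *\<^sub>v (S *\<^sub>v w))"
proof -
  have "(T *\<^sub>v u) \<bullet> (S *\<^sub>v w) = (S *\<^sub>v w) \<bullet> (T *\<^sub>v u)"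
    using assms by (intro comm_scalar_prod[of _ n]) auto
  also have "\<dots> = (transpose_mat T *\<^sub>v (S *\<^sub>v w)) \<bullet> u"
    using assms by (intro transpose_vec_mult_scalar[symmetric, of _ n m]) auto
  also have "\<dots> = u \<bullet> (transpose_mat T *\<^sub>v (S *\<^sub>v w))"
    using assms by (intro comm_scalar_prod[of _ m]) auto
  finally show ?thesis unfolding energy_inner_def .
qed

context
  fixes n :: nat and S :: "real mat"
  assumes spd: "spd n S"
begin

lemma energy_inner_commute:
  "u \<in> carrier_vec n \<Longrightarrow> v \<in> carrier_vec n \<Longrightarrow> energy_inner S u v = energy_inner S v u"
proof -
  assume u: "u \<in> carrier_vec n" and v: "v \<in> carrier_vec n"
  have S: "S \<in> carrier_mat n n" "transpose_mat S = S" using spd by (auto simp: spd_def)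
  have "u \<bullet> (S *\<^sub>v v) = (S *\<^sub>v u) \<bullet> v"
    using transpose_vec_mult_scalar[OF S(1) v u] S(2) by simp
  also have "\<dots> = v \<bullet> (S *\<^sub>v u)" using S u v by (intro comm_scalar_prod[of _ n]) auto
  finally show ?thesis unfolding energy_inner_def .
qed

lemma energy_inner_pos: "v \<in> carrier_vec n \<Longrightarrow> v \<noteq> 0\<^sub>v n \<Longrightarrow> 0 < energy_inner S v v"
  using spd by (auto simp: spd_def energy_inner_def)

lemma energy_inner_nonneg: "v \<in> carrier_vec n \<Longrightarrow> 0 \<le> energy_inner S v v"
  using energy_inner_pos[of v] energy_inner_zero_right[OF spd_carrier[OF spd], of v] by force

lemma energy_inner_eq_0_iff: "v \<in> carrier_vec n \<Longrightarrow> energy_inner S v v = 0 \<longleftrightarrow> v = 0\<^sub>v n"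
  using energy_inner_pos[of v] energy_inner_zero_right[OF spd_carrier[OF spd], of v] by force

lemma energy_norm_sq: "v \<in> carrier_vec n \<Longrightarrow> (energy_norm S v)\<^sup>2 = energy_inner S v v"
  using energy_inner_nonneg[of v] by (simp add: energy_norm_def energy_inner_def)

lemma energy_Cauchy_Schwarz:
  assumes u: "u \<in> carrier_vec n" and v: "v \<in> carrier_vec n"
  shows "(energy_inner S u v)\<^sup>2 \<le> energy_inner S u u * energy_inner S v v"
proof (cases "v = 0\<^sub>v n")
  case True
  thus ?thesis using energy_inner_zero_right[OF spd_carrier[OF spd]] u v by simp
next
  case False
  note S = spd_carrier[OF spd]
  let ?a = "energy_inner S u v" and ?b = "energy_inner S v v"
  have b: "0 < ?b" using energy_inner_pos[OF v False] .
  define w where "w = u + (- ?a / ?b) \<cdot>\<^sub>v v"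
  have w: "w \<in> carrier_vec n" using u v unfolding w_def by auto
  have "energy_inner S w w = energy_inner S u u - ?a\<^sup>2 / ?b"
    unfolding w_def using u v b
    by (simp add: energy_inner_add_left[OF S] energy_inner_add_right[OF S]
        energy_inner_smult_left[OF S] energy_inner_smult_right[OF S]
        energy_inner_commute[of v u] power2_eq_square field_simps)
  with energy_inner_nonneg[OF w] have "?a\<^sup>2 / ?b \<le> energy_inner S u u" by simp
  thus ?thesis using b by (simp add: field_simps)
qed

end

section \<open>Polynomials acting on a vector\<close>

text \<open>Matrices of unspecified size have no additive type class, so the ring homomorphism \<open>p \<mapsto> p(X)\<close>
  is established through its action on vectors.\<close>

lemma poly_mat_carrier: "X \<in> carrier_mat n n \<Longrightarrow> poly_mat p X \<in> carrier_mat n n"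
  by (auto simp: poly_mat_def)

definition poly_act :: "real mat \<Rightarrow> real poly \<Rightarrow> real vec \<Rightarrow> real vec" where
  "poly_act X p v = poly_mat p X *\<^sub>v v"

lemma poly_mat_index:
  assumes "X \<in> carrier_mat n n" "degree p \<le> N" "i < n" "j < n"
  shows "poly_mat p X $$ (i, j) = (\<Sum>k\<le>N. coeff p k * (X ^\<^sub>m k) $$ (i, j))"
proof -
  have "(\<Sum>k\<le>degree p. coeff p k * (X ^\<^sub>m k) $$ (i, j)) = (\<Sum>k\<le>N. coeff p k * (X ^\<^sub>m k) $$ (i, j))"
    using assms by (intro sum.mono_neutral_left) (auto simp: coeff_eq_0)
  thus ?thesis using assms unfolding poly_mat_def by auto
qed

lemma pow_mat_Suc_left:
  fixes X :: "real mat"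
  assumes X: "X \<in> carrier_mat n n"
  shows "X ^\<^sub>m Suc k = X * X ^\<^sub>m k"
proof (induction k)
  case (Suc k)
  have "X ^\<^sub>m Suc (Suc k) = (X * X ^\<^sub>m k) * X" using Suc by simp
  also have "\<dots> = X * (X ^\<^sub>m k * X)"
    using X by (intro assoc_mult_mat[of _ n n _ n _ n] pow_carrier_mat) auto
  finally show ?case by simp
qed (use X in auto)

lemma poly_mat_0: "X \<in> carrier_mat n n \<Longrightarrow> poly_mat 0 X = 0\<^sub>m n n"
  unfolding poly_mat_def by (intro eq_matI) auto

lemma poly_mat_pCons:
  assumes X: "X \<in> carrier_mat n n"
  shows "poly_mat (pCons a p) X = a \<cdot>\<^sub>m 1\<^sub>m n + X * poly_mat p X"
proof (rule eq_matI)
  fix i j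
  assume "i < dim_row (a \<cdot>\<^sub>m 1\<^sub>m n + X * poly_mat p X)"
    and "j < dim_col (a \<cdot>\<^sub>m 1\<^sub>m n + X * poly_mat p X)"
  hence i: "i < n" and j: "j < n" using X poly_mat_carrier[OF X, of p] by auto
  have Xk: "X ^\<^sub>m k \<in> carrier_mat n n" for k using X by (rule pow_carrier_mat)
  let ?N = "degree p"
  have "poly_mat (pCons a p) X $$ (i, j)
      = (\<Sum>k\<le>Suc ?N. coeff (pCons a p) k * (X ^\<^sub>m k) $$ (i, j))"
    using X i j by (intro poly_mat_index) (auto simp: degree_pCons_le)
  also have "\<dots> = a * (1\<^sub>m n) $$ (i, j) + (\<Sum>k\<le>?N. coeff p k * (X * X ^\<^sub>m k) $$ (i, j))"
    unfolding sum.atMost_Suc_shift coeff_pCons_0 coeff_pCons_Suc pow_mat_Suc_left[OF X]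
    using X by simp
  also have "(\<Sum>k\<le>?N. coeff p k * (X * X ^\<^sub>m k) $$ (i, j))
      = (\<Sum>k\<le>?N. \<Sum>r<n. coeff p k * (X $$ (i, r) * (X ^\<^sub>m k) $$ (r, j)))"
  proof (intro sum.cong refl)
    fix k
    have "(X * X ^\<^sub>m k) $$ (i, j) = (\<Sum>r<n. X $$ (i, r) * (X ^\<^sub>m k) $$ (r, j))"
      using X Xk[of k] i j by (simp add: scalar_prod_def atLeast0LessThan)
    thus "coeff p k * (X * X ^\<^sub>m k) $$ (i, j)
      = (\<Sum>r<n. coeff p k * (X $$ (i, r) * (X ^\<^sub>m k) $$ (r, j)))"
      by (simp add: sum_distrib_left)
  qed
  also have "\<dots> = (\<Sum>r<n. X $$ (i, r) * (\<Sum>k\<le>?N. coeff p k * (X ^\<^sub>m k) $$ (r, j)))"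
    by (subst sum.swap) (simp add: sum_distrib_left mult_ac)
  also have "\<dots> = (\<Sum>r<n. X $$ (i, r) * poly_mat p X $$ (r, j))"
    using X j by (intro sum.cong refl) (simp add: poly_mat_index[OF X order_refl])
  also have "\<dots> = (X * poly_mat p X) $$ (i, j)"
    using X poly_mat_carrier[OF X, of p] i j by (simp add: scalar_prod_def atLeast0LessThan)
  finally show "poly_mat (pCons a p) X $$ (i, j) = (a \<cdot>\<^sub>m 1\<^sub>m n + X * poly_mat p X) $$ (i, j)"
    using X poly_mat_carrier[OF X, of p] i j by simp
qed (use X poly_mat_carrier[OF X] in \<open>auto simp: poly_mat_def\<close>)

context
  fixes n :: nat and X :: "real mat"
  assumes X: "X \<in> carrier_mat n n"
begin

lemma poly_act_carrier [simp]: "v \<in> carrier_vec n \<Longrightarrow> poly_act X p v \<in> carrier_vec n"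
  unfolding poly_act_def using mult_mat_vec_carrier[OF poly_mat_carrier[OF X]] .

lemma poly_act_0 [simp]: "v \<in> carrier_vec n \<Longrightarrow> poly_act X 0 v = 0\<^sub>v n"
  unfolding poly_act_def poly_mat_0[OF X] by (intro eq_vecI) auto

lemma poly_act_pCons:
  assumes "v \<in> carrier_vec n"
  shows "poly_act X (pCons a p) v = a \<cdot>\<^sub>v v + X *\<^sub>v poly_act X p v"
proof -
  note P = poly_mat_carrier[OF X, of p]
  have "(a \<cdot>\<^sub>m 1\<^sub>m n) *\<^sub>v v = a \<cdot>\<^sub>v v"
    using assms by (intro eq_vecI) (auto simp: scalar_prod_def if_distribR if_distrib sum.If_cases cong: if_cong)
  thus ?thesis
    unfolding poly_act_def poly_mat_pCons[OF X] using X P assms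
    by (simp add: add_mult_distrib_mat_vec[of _ n n])
qed

lemma poly_act_zero_vec [simp]: "poly_act X p (0\<^sub>v n) = 0\<^sub>v n"
  unfolding poly_act_def using poly_mat_carrier[OF X] by simp

lemma poly_act_linear:
  assumes v: "v \<in> carrier_vec n"
  shows "poly_act X [:- a, 1:] v = X *\<^sub>v v - a \<cdot>\<^sub>v v"
  using v X by (auto simp: poly_act_pCons mult_mat_zero_vec[OF X])

lemma poly_act_add:
  assumes v: "v \<in> carrier_vec n"
  shows "poly_act X (p + q) v = poly_act X p v + poly_act X q v"
proof (induction p q rule: poly_induct2)
  case (pCons a p b q)
  have "X *\<^sub>v (poly_act X p v + poly_act X q v)
      = X *\<^sub>v poly_act X p v + X *\<^sub>v poly_act X q v"
    using v X by (intro mult_add_distrib_mat_vec) auto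
  thus ?case using v X pCons
    by (simp add: poly_act_pCons) (intro eq_vecI, auto simp: algebra_simps)
qed (use v in auto)

lemma poly_act_smult:
  assumes v: "v \<in> carrier_vec n"
  shows "poly_act X (Polynomial.smult c p) v = c \<cdot>\<^sub>v poly_act X p v"
proof (induction p rule: pCons_induct)
  case (pCons a p)
  thus ?case using v X
    by (simp add: poly_act_pCons mult_mat_vec[OF X]) (intro eq_vecI, auto simp: algebra_simps)
qed (use v in auto)

lemma poly_act_mult:
  assumes v: "v \<in> carrier_vec n"
  shows "poly_act X (p * q) v = poly_act X p (poly_act X q v)"
proof (induction p rule: pCons_induct)
  case (pCons a p)
  have "poly_act X (pCons a p * q) v = a \<cdot>\<^sub>v poly_act X q v + (0 \<cdot>\<^sub>v v + X *\<^sub>v poly_act X (p * q) v)"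
    using v by (simp add: poly_act_add poly_act_smult poly_act_pCons)
  also have "0 \<cdot>\<^sub>v v + X *\<^sub>v poly_act X (p * q) v = X *\<^sub>v poly_act X (p * q) v"
    using v X by (intro eq_vecI) auto
  also have "a \<cdot>\<^sub>v poly_act X q v + \<dots> = poly_act X (pCons a p) (poly_act X q v)"
    using v X pCons by (simp add: poly_act_pCons)
  finally show ?case .
qed (use v in auto)

text \<open>The vectors \<open>v, X v, \<dots>, X\<^sup>n v\<close> are \<open>n + 1\<close> vectors in dimension \<open>n\<close>; a linear
  relation between them is a polynomial annihilating \<open>v\<close>.\<close>

lemma poly_act_annihilator:
  assumes v: "v \<in> carrier_vec n"
  obtains f where "f \<noteq> 0" "poly_act X f v = 0\<^sub>v n"
proof -
  define D where "D = mat n (Suc n) (\<lambda>(i, k). (X ^\<^sub>m k *\<^sub>v v) $ i)"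
  have D: "D \<in> carrier_mat n (Suc n)" by (auto simp: D_def)
  obtain c where c: "c \<in> carrier_vec (Suc n)" "c \<noteq> 0\<^sub>v (Suc n)" "D *\<^sub>v c = 0\<^sub>v n"
    using wide_matrix_kernel[OF D lessI] by blast
  define f where "f = Poly (list_of_vec c)"
  have coeff_f: "coeff f k = (if k \<le> n then c $ k else 0)" for k
    using c(1) by (auto simp: f_def nth_default_def list_of_vec_index)
  have "f \<noteq> 0"
  proof
    assume "f = 0"
    hence "c $ k = 0" if "k \<le> n" for k using coeff_f[of k] that by simp
    hence "c = 0\<^sub>v (Suc n)" using c(1) by (intro eq_vecI) (auto simp: less_Suc_eq_le)
    with c(2) show False by simp
  qed
  moreover have "poly_act X f v = 0\<^sub>v n"
  proof (rule eq_vecI)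
    fix i assume "i < dim_vec (0\<^sub>v n :: real vec)"
    hence i: "i < n" by simp
    have deg: "degree f \<le> n" by (rule degree_le) (auto simp: coeff_f)
    have Xk: "X ^\<^sub>m k \<in> carrier_mat n n" for k using X by (rule pow_carrier_mat)
    have "poly_act X f v $ i = (\<Sum>j<n. poly_mat f X $$ (i, j) * v $ j)"
      unfolding poly_act_def using poly_mat_carrier[OF X, of f] v i
      by (simp add: scalar_prod_def atLeast0LessThan)
    also have "\<dots> = (\<Sum>j<n. \<Sum>k\<le>n. coeff f k * ((X ^\<^sub>m k) $$ (i, j) * v $ j))"
      using i by (intro sum.cong refl)
        (simp add: poly_mat_index[OF X deg] sum_distrib_right mult.assoc)
    also have "\<dots> = (\<Sum>k\<le>n. c $ k * (\<Sum>j<n. (X ^\<^sub>m k) $$ (i, j) * v $ j))"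
      by (subst sum.swap) (simp add: coeff_f sum_distrib_left)
    also have "\<dots> = (\<Sum>k\<le>n. D $$ (i, k) * c $ k)"
    proof (intro sum.cong refl)
      fix k assume "k \<in> {..n}"
      thus "c $ k * (\<Sum>j<n. (X ^\<^sub>m k) $$ (i, j) * v $ j) = D $$ (i, k) * c $ k"
        using i Xk[of k] v carrier_vecD[OF v] carrier_matD[OF Xk[of k]]
        unfolding D_def by (simp add: scalar_prod_def atLeast0LessThan mult.commute)
    qed
    also have "\<dots> = (D *\<^sub>v c) $ i"
      using i D carrier_vecD[OF c(1)]
      by (simp add: scalar_prod_def atLeast0LessThan lessThan_Suc_atMost del: sum.atMost_Suc sum.lessThan_Suc)
    also have "\<dots> = 0" using i c by simp
    finally show "poly_act X f v $ i = 0\<^sub>v n $ i" using i by simp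
  qed (use v in auto)
  ultimately show ?thesis using that by blast
qed

end

section \<open>Polynomial functional calculus of a self-adjoint matrix\<close>

lemma prod_linear_factors_dvd:
  fixes g :: "'a::field poly"
  assumes "finite \<Lambda>" "\<And>a. a \<in> \<Lambda> \<Longrightarrow> poly g a = 0"
  shows "(\<Prod>a\<in>\<Lambda>. [:- a, 1:]) dvd g"
  using assms
proof (induction \<Lambda> rule: finite_induct)
  case (insert a \<Lambda>)
  hence "(\<Prod>b\<in>\<Lambda>. [:- b, 1:]) dvd g" by simp
  then obtain k where k: "g = k * (\<Prod>b\<in>\<Lambda>. [:- b, 1:])" by (metis dvdE mult.commute)
  have "poly (\<Prod>b\<in>\<Lambda>. [:- b, 1:]) a \<noteq> 0"
    using insert by (auto simp: poly_prod)
  moreover have "poly g a = 0" using insert by auto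
  ultimately have "[:- a, 1:] dvd k" unfolding k by (simp add: poly_eq_0_iff_dvd)
  hence "[:- a, 1:] * (\<Prod>b\<in>\<Lambda>. [:- b, 1:]) dvd k * (\<Prod>b\<in>\<Lambda>. [:- b, 1:])"
    by (intro mult_dvd_mono dvd_refl)
  thus ?case unfolding k by (simp only: prod.insert[OF insert.hyps])
qed auto

context
  fixes n :: nat and S X :: "real mat"
  assumes spd: "spd n S"
    and X: "X \<in> carrier_mat n n"
    and self_adjoint: "\<And>u v. u \<in> carrier_vec n \<Longrightarrow> v \<in> carrier_vec n \<Longrightarrow>
      energy_inner S (X *\<^sub>v u) v = energy_inner S u (X *\<^sub>v v)"
begin

lemma poly_act_self_adjoint:
  assumes u: "u \<in> carrier_vec n" and v: "v \<in> carrier_vec n"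
  shows "energy_inner S (poly_act X p u) v = energy_inner S u (poly_act X p v)"
  using v
proof (induction p arbitrary: v rule: pCons_induct)
  case 0
  thus ?case using u
    by (simp add: poly_act_0[OF X] energy_inner_zero_right[OF spd_carrier[OF spd]]
        energy_inner_commute[OF spd zero_carrier_vec])
next
  case (pCons a p)
  note v = pCons.prems
  have comm: "poly_act X p (X *\<^sub>v v) = X *\<^sub>v poly_act X p v"
  proof -
    have X1: "X *\<^sub>v w = poly_act X [:- 0, 1:] w" if "w \<in> carrier_vec n" for w
      unfolding poly_act_linear[OF X that] using that X by (intro eq_vecI) auto
    have "poly_act X p (X *\<^sub>v v) = poly_act X (p * [:- 0, 1:]) v"
      using v by (simp only: X1 poly_act_mult[OF X])
    also have "\<dots> = poly_act X ([:- 0, 1:] * p) v" by (simp add: mult.commute)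
    also have "\<dots> = X *\<^sub>v poly_act X p v"
      using v by (simp only: X1 poly_act_mult[OF X] poly_act_carrier[OF X])
    finally show ?thesis .
  qed
  show ?case
    using u v pCons.IH[of "X *\<^sub>v v"] X
    by (simp add: poly_act_pCons[OF X] poly_act_carrier[OF X] comm self_adjoint
        energy_inner_add_left[OF spd_carrier[OF spd]] energy_inner_add_right[OF spd_carrier[OF spd]]
        energy_inner_smult_left[OF spd_carrier[OF spd]] pCons.IH
        energy_inner_smult_right[OF spd_carrier[OF spd]])
qed

text \<open>Take an annihilator \<open>f\<close> of \<open>v\<close> of least degree.  It cannot be divisible by
  \<open>(x - a)\<^sup>2 + b\<^sup>2\<close> with \<open>b \<noteq> 0\<close> and quotient \<open>h\<close>: for \<open>w = h(X) v\<close> this would give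
  \<open>\<parallel>(X - a) w\<parallel>\<^sup>2 + b\<^sup>2 \<parallel>w\<parallel>\<^sup>2 = 0\<close> by self-adjointness, hence \<open>w = 0\<close>, against minimality.
  With \<open>b = 0\<close> the same identity gives \<open>(X - a) w = 0\<close>, which excludes multiple roots.  So \<open>f\<close>
  is a constant multiple of the product over its real roots, and the cofactor of each root maps
  \<open>v\<close> to an eigenvector.\<close>

lemma annihilator_distinct_eigenvalues:
  assumes v: "v \<in> carrier_vec n"
  obtains \<Lambda> where "finite \<Lambda>" "poly_act X (\<Prod>a\<in>\<Lambda>. [:- a, 1:]) v = 0\<^sub>v n"
    "\<And>a. a \<in> \<Lambda> \<Longrightarrow> eigenvalue X a"
proof -
  note act_carrier = poly_act_carrier[OF X]
  note act_mult = poly_act_mult[OF X]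
  note S = spd_carrier[OF spd]
  have "\<exists>f. (f \<noteq> 0 \<and> poly_act X f v = 0\<^sub>v n) \<and>
      (\<forall>h. h \<noteq> 0 \<and> poly_act X h v = 0\<^sub>v n \<longrightarrow> degree f \<le> degree h)"
  proof -
    obtain f0 where "f0 \<noteq> 0 \<and> poly_act X f0 v = 0\<^sub>v n" using poly_act_annihilator[OF X v] by blast
    thus ?thesis by (rule ex_has_least_nat)
  qed
  then obtain f where f: "f \<noteq> 0" "poly_act X f v = 0\<^sub>v n"
    and least: "\<And>h. h \<noteq> 0 \<Longrightarrow> poly_act X h v = 0\<^sub>v n \<Longrightarrow> degree f \<le> degree h" by blast
  have cofactor: "poly_act X h v \<noteq> 0\<^sub>v n" if "f = d * h" "degree d > 0" for d h
  proof
    assume "poly_act X h v = 0\<^sub>v n"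
    moreover have "d \<noteq> 0" "h \<noteq> 0" using f that by auto
    ultimately show False using least[of h] that by (simp add: degree_mult_eq)
  qed
  \<comment> \<open>Only the case \<open>b = 0\<close> survives; its second conclusion then says \<open>(X - a) w = 0\<close>.\<close>
  have quadratic: "b = 0 \<and> poly_act X ([:- a, 1:] * h) v = 0\<^sub>v n"
    if fh: "f = ([:- a, 1:]\<^sup>2 + [:b\<^sup>2:]) * h" for a b :: real and h
  proof -
    define w where "w = poly_act X h v"
    define u where "u = poly_act X [:- a, 1:] w"
    have w: "w \<in> carrier_vec n" and u: "u \<in> carrier_vec n"
      unfolding u_def w_def using act_carrier v by auto
    have "degree ([:- a, 1:]\<^sup>2 + [:b\<^sup>2:]) > 0"
      by (simp add: power2_eq_square degree_add_eq_left)
    hence "w \<noteq> 0\<^sub>v n" unfolding w_def using cofactor fh by blast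
    hence pos: "energy_inner S w w > 0" using energy_inner_pos[OF spd w] by blast
    have const: "poly_act X [:b\<^sup>2:] w = b\<^sup>2 \<cdot>\<^sub>v w"
      using w X by (simp add: poly_act_pCons[OF X] poly_act_0[OF X])
    have "0\<^sub>v n = poly_act X ([:- a, 1:]\<^sup>2 + [:b\<^sup>2:]) w"
      using f fh v by (simp add: w_def act_mult)
    also have "\<dots> = poly_act X [:- a, 1:] u + b\<^sup>2 \<cdot>\<^sub>v w"
      using w by (simp only: poly_act_add[OF X] const power2_eq_square[of "[:- a, 1:]"]
          act_mult u_def)
    finally have "0 = energy_inner S w (poly_act X [:- a, 1:] u + b\<^sup>2 \<cdot>\<^sub>v w)"
      using energy_inner_zero_right[OF S w] by simp
    also have "\<dots> = energy_inner S u u + b\<^sup>2 * energy_inner S w w"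
      using w u act_carrier poly_act_self_adjoint[OF w u]
      by (simp add: energy_inner_add_right[OF S] energy_inner_smult_right[OF S] u_def)
    finally have "energy_inner S u u + b\<^sup>2 * energy_inner S w w = 0" by simp
    moreover have "0 \<le> energy_inner S u u" using energy_inner_nonneg[OF spd u] .
    moreover have "0 \<le> b\<^sup>2 * energy_inner S w w" using pos by simp
    ultimately have "energy_inner S u u = 0" "b\<^sup>2 * energy_inner S w w = 0" by linarith+
    thus ?thesis
      using pos energy_inner_eq_0_iff[OF spd u] v by (simp only: u_def w_def act_mult) simp
  qed
  have simple: False if "[:- a, 1:] * [:- a, 1:] dvd f" for a
  proof -
    from that obtain h where h: "f = [:- a, 1:] * [:- a, 1:] * h" by (elim dvdE)
    have "f = ([:- a, 1:]\<^sup>2 + [:0\<^sup>2:]) * h"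
      unfolding h by (simp only: power2_eq_square mult_zero_left pCons_0_0 add_0_right)
    hence "poly_act X ([:- a, 1:] * h) v = 0\<^sub>v n" using quadratic by blast
    moreover have "f = [:- a, 1:] * ([:- a, 1:] * h)" unfolding h by (rule mult.assoc)
    ultimately show False using cofactor[of "[:- a, 1:]" "[:- a, 1:] * h"] by simp
  qed
  let ?c = "map_poly complex_of_real"
  interpret c: map_poly_comm_ring_hom complex_of_real ..
  have real_root: "Im z = 0" if z: "poly (?c f) z = 0" for z
  proof (rule ccontr)
    assume im: "Im z \<noteq> 0"
    define d where "d = [:- Re z, 1:]\<^sup>2 + [:(Im z)\<^sup>2:]"
    have d: "d = [:(Re z)\<^sup>2 + (Im z)\<^sup>2, - 2 * Re z, 1:]"
      by (simp add: d_def power2_eq_square)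
    have dz: "poly (?c d) z = 0"
      by (simp add: d complex_eq_iff power2_eq_square algebra_simps)
    have "?c f = ?c (d * (f div d) + f mod d)" by simp
    also have "\<dots> = ?c d * ?c (f div d) + ?c (f mod d)" by (simp only: c.hom_add c.hom_mult)
    finally have rz: "poly (?c (f mod d)) z = 0" using z dz by simp
    have deg: "degree (f mod d) < 2" using degree_mod_less[of d f] by (auto simp: d)
    define p q where "p = coeff (f mod d) 0" and "q = coeff (f mod d) 1"
    have r: "f mod d = [:p, q:]"
    proof (rule poly_eqI)
      fix k :: nat
      consider "k = 0" | "k = 1" | "2 \<le> k" by linarith
      thus "coeff (f mod d) k = coeff [:p, q:] k"
      proof cases
        case 3
        thus ?thesis using deg by (simp add: coeff_eq_0)
      qed (simp_all add: p_def q_def)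
    qed
    have "poly (?c (f mod d)) z = of_real p + z * of_real q"
      unfolding r by (simp add: of_real_hom.map_poly_pCons_hom)
    with rz have eq: "of_real p + z * of_real q = 0" by simp
    from arg_cong[OF eq, of Im] im have "q = 0" by simp
    with eq have "p = 0" by simp
    with \<open>q = 0\<close> r have "d dvd f" by (simp add: dvd_eq_mod_eq_0)
    then obtain h where "f = d * h" by (elim dvdE)
    with quadratic[of "Re z" "Im z" h] im show False by (simp add: d_def)
  qed
  define \<Lambda> where "\<Lambda> = {a. poly f a = 0}"
  have fin: "finite \<Lambda>" unfolding \<Lambda>_def using poly_roots_finite[OF f(1)] .
  let ?P = "\<Prod>a\<in>\<Lambda>. [:- a, 1:]"
  have "?P dvd f" using fin by (rule prod_linear_factors_dvd) (auto simp: \<Lambda>_def)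
  then obtain h where h: "f = ?P * h" by (elim dvdE)
  have "degree h = 0"
  proof (rule ccontr)
    assume "degree h \<noteq> 0"
    hence "\<not> constant (poly (?c h))" by (simp add: constant_degree)
    then obtain z where z: "poly (?c h) z = 0" using fundamental_theorem_of_algebra by blast
    have "?c f = ?c ?P * ?c h" unfolding h by (simp add: c.hom_mult)
    hence "Im z = 0" using real_root[of z] z by simp
    hence z_eq: "z = of_real (Re z)" by (simp add: complex_eq_iff)
    from z have hz: "poly h (Re z) = 0" by (subst (asm) z_eq) simp
    have "poly f (Re z) = 0" by (subst h) (simp add: hz)
    hence "Re z \<in> \<Lambda>" unfolding \<Lambda>_def by simp
    hence "[:- Re z, 1:] dvd ?P" using fin by (rule dvd_prodI[rotated])
    moreover have "[:- Re z, 1:] dvd h" using hz by (simp add: poly_eq_0_iff_dvd)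
    ultimately have "[:- Re z, 1:] * [:- Re z, 1:] dvd f" unfolding h by (rule mult_dvd_mono)
    thus False by (rule simple)
  qed
  then obtain c where c: "h = [:c:]" by (rule degree_eq_zeroE)
  have fc: "f = Polynomial.smult c ?P" using h c by simp
  have "?P = Polynomial.smult (inverse c) f" using f(1) fc by auto
  hence "poly_act X ?P v = inverse c \<cdot>\<^sub>v poly_act X f v" using poly_act_smult[OF X v] by simp
  hence ann: "poly_act X ?P v = 0\<^sub>v n" using f(2) by auto
  have eig: "eigenvalue X a" if "a \<in> \<Lambda>" for a
  proof -
    from that obtain k where k: "f = [:- a, 1:] * k"
      by (auto simp: \<Lambda>_def poly_eq_0_iff_dvd elim!: dvdE)
    define u where "u = poly_act X k v"
    have u: "u \<in> carrier_vec n" unfolding u_def using act_carrier v by auto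
    have u0: "u \<noteq> 0\<^sub>v n" unfolding u_def using cofactor[OF k] by simp
    have "X *\<^sub>v u - a \<cdot>\<^sub>v u = 0\<^sub>v n"
      using f(2) unfolding k act_mult[OF v] u_def[symmetric] poly_act_linear[OF X u] .
    hence "(X *\<^sub>v u - a \<cdot>\<^sub>v u) $ i = 0" if "i < n" for i using that by simp
    hence "X *\<^sub>v u = a \<cdot>\<^sub>v u" using X u by (intro eq_vecI) auto
    thus ?thesis unfolding eigenvalue_def eigenvector_def using X u u0 by blast
  qed
  show ?thesis using that[OF fin ann eig] by blast
qed

text \<open>Modulo the product \<open>\<Pi>\<close> over the eigenvalues that occur in \<open>v\<close>, a polynomial \<open>g\<close> equals
  its Lagrange interpolant there, so \<open>\<langle>v, g(X) v\<rangle> = \<Sum>a. g(a) \<langle>v, l\<^sub>a(X) v\<rangle>\<close>.  The basis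
  polynomials \<open>l\<^sub>a\<close> are idempotent modulo \<open>\<Pi>\<close>, which turns the weights into squared norms.\<close>

lemma poly_act_spectral_measure:
  assumes v: "v \<in> carrier_vec n"
  obtains \<Lambda> w where "finite \<Lambda>" "\<And>a. a \<in> \<Lambda> \<Longrightarrow> eigenvalue X a" "\<And>a. 0 \<le> w a"
    "\<And>g. energy_inner S v (poly_act X g v) = (\<Sum>a\<in>\<Lambda>. w a * poly g a)"
proof -
  note S = spd_carrier[OF spd]
  note [simp] = poly_act_carrier[OF X]
  obtain \<Lambda> where fin: "finite \<Lambda>" and ann: "poly_act X (\<Prod>a\<in>\<Lambda>. [:- a, 1:]) v = 0\<^sub>v n"
    and eig: "\<And>a. a \<in> \<Lambda> \<Longrightarrow> eigenvalue X a"
    using annihilator_distinct_eigenvalues[OF v] by blast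
  define m where "m g = energy_inner S v (poly_act X g v)" for g
  have m_add: "m (f + g) = m f + m g" for f g
    using v by (simp add: m_def poly_act_add[OF X] energy_inner_add_right[OF S])
  have m_smult: "m (Polynomial.smult c g) = c * m g" for c g
    using v by (simp add: m_def poly_act_smult[OF X] energy_inner_smult_right[OF S])
  have m_0: "m 0 = 0" using m_smult[of 0 0] by simp
  have m_sum: "m (\<Sum>a\<in>\<Lambda>. h a) = (\<Sum>a\<in>\<Lambda>. m (h a))" for h
    using fin by induction (auto simp: m_0 m_add)
  have m_cong: "m f = m g" if "\<And>a. a \<in> \<Lambda> \<Longrightarrow> poly f a = poly g a" for f g
  proof -
    have "(\<Prod>a\<in>\<Lambda>. [:- a, 1:]) dvd f - g"
      using fin that by (intro prod_linear_factors_dvd) auto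
    then obtain k where "f - g = (\<Prod>a\<in>\<Lambda>. [:- a, 1:]) * k" by (elim dvdE)
    hence "f = g + k * (\<Prod>a\<in>\<Lambda>. [:- a, 1:])" by (simp add: algebra_simps)
    hence "m f = m g + m (k * (\<Prod>a\<in>\<Lambda>. [:- a, 1:]))" using m_add by simp
    also have "m (k * (\<Prod>a\<in>\<Lambda>. [:- a, 1:])) = 0"
      using v ann energy_inner_zero_right[OF S v]
      by (simp add: m_def poly_act_mult[OF X] poly_act_zero_vec[OF X])
    finally show ?thesis by simp
  qed
  define lag where "lag a = Polynomial.smult (inverse (\<Prod>b\<in>\<Lambda>-{a}. a - b)) (\<Prod>b\<in>\<Lambda>-{a}. [:- b, 1:])" for a
  have lag: "poly (lag a) b = (if b = a then 1 else 0)" if "a \<in> \<Lambda>" "b \<in> \<Lambda>" for a b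
    using fin that by (auto simp: lag_def poly_prod)
  define w where "w a = (if a \<in> \<Lambda> then m (lag a) else 0)" for a
  have "0 \<le> w a" for a
  proof (cases "a \<in> \<Lambda>")
    case True
    hence "w a = m (lag a * lag a)" unfolding w_def by (auto simp: lag intro!: m_cong)
    also have "\<dots> = energy_inner S (poly_act X (lag a) v) (poly_act X (lag a) v)"
      using v by (simp add: m_def poly_act_mult[OF X] poly_act_self_adjoint)
    finally show ?thesis using v energy_inner_nonneg[OF spd] by simp
  qed (simp add: w_def)
  moreover have "m g = (\<Sum>a\<in>\<Lambda>. w a * poly g a)" for g
  proof -
    have "m g = m (\<Sum>a\<in>\<Lambda>. Polynomial.smult (poly g a) (lag a))"
    proof (rule m_cong)
      fix b assume b: "b \<in> \<Lambda>"
      have "poly (\<Sum>a\<in>\<Lambda>. Polynomial.smult (poly g a) (lag a)) b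
          = (\<Sum>a\<in>\<Lambda>. if b = a then poly g a else 0)"
        unfolding poly_sum using b by (intro sum.cong) (auto simp: lag)
      thus "poly g b = poly (\<Sum>a\<in>\<Lambda>. Polynomial.smult (poly g a) (lag a)) b" using fin b by simp
    qed
    thus ?thesis by (simp add: m_sum m_smult w_def mult.commute)
  qed
  ultimately show ?thesis using that[OF fin eig, of w] by (simp add: m_def)
qed

text \<open>The weights of the spectral measure are nonnegative, so an inequality between polynomials on the
  eigenvalues passes to the quadratic forms.\<close>

lemma poly_act_mono:
  assumes v: "v \<in> carrier_vec n"
    and le: "\<And>a. eigenvalue X a \<Longrightarrow> poly f a \<le> poly g a"
  shows "energy_inner S v (poly_act X f v) \<le> energy_inner S v (poly_act X g v)"
proof -
  obtain \<Lambda> w where "finite \<Lambda>" "\<And>a. a \<in> \<Lambda> \<Longrightarrow> eigenvalue X a" "\<And>a. 0 \<le> w a"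
    and "\<And>g. energy_inner S v (poly_act X g v) = (\<Sum>a\<in>\<Lambda>. w a * poly g a)"
    using poly_act_spectral_measure[OF v] by blast
  thus ?thesis using le by (auto intro!: sum_mono mult_left_mono)
qed

end

section \<open>Preconditioned operators\<close>

context
  fixes n :: nat and A B :: "real mat"
  assumes A_spd: "spd n A" and B_spd: "spd n B"
begin

private lemma A: "A \<in> carrier_mat n n" and B: "B \<in> carrier_mat n n"
  using A_spd B_spd by (auto simp: spd_carrier)

private lemma BA: "B * A \<in> carrier_mat n n"
  using A B by auto

lemma preconditioned_inner:
  assumes u: "u \<in> carrier_vec n" and v: "v \<in> carrier_vec n"
  shows "energy_inner A u ((B * A) *\<^sub>v v) = energy_inner B (A *\<^sub>v u) (A *\<^sub>v v)"
proof -
  have "transpose_mat A = A" using A_spd by (simp add: spd_def)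
  thus ?thesis using energy_inner_adjoint[OF A B u, of "A *\<^sub>v v"] A B u v
    by (simp add: energy_inner_def)
qed

lemma preconditioned_self_adjoint:
  assumes u: "u \<in> carrier_vec n" and v: "v \<in> carrier_vec n"
  shows "energy_inner A ((B * A) *\<^sub>v u) v = energy_inner A u ((B * A) *\<^sub>v v)"
proof -
  have "energy_inner A ((B * A) *\<^sub>v u) v = energy_inner A v ((B * A) *\<^sub>v u)"
    using u v BA by (intro energy_inner_commute[OF A_spd]) auto
  also have "\<dots> = energy_inner B (A *\<^sub>v u) (A *\<^sub>v v)"
    using u v A by (subst preconditioned_inner)
      (auto intro: energy_inner_commute[OF B_spd])
  finally show ?thesis using preconditioned_inner u v by simp
qed

lemma spd_mult_nonzero: "v \<in> carrier_vec n \<Longrightarrow> v \<noteq> 0\<^sub>v n \<Longrightarrow> A *\<^sub>v v \<noteq> 0\<^sub>v n"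
  using energy_inner_pos[OF A_spd, of v] by (auto simp: energy_inner_def)

lemma preconditioned_eigenvalue_pos:
  assumes "eigenvalue (B * A) a"
  shows "0 < a"
proof -
  from assms obtain u where u: "u \<in> carrier_vec n" "u \<noteq> 0\<^sub>v n" "(B * A) *\<^sub>v u = a \<cdot>\<^sub>v u"
    using B unfolding eigenvalue_def eigenvector_def by auto
  have "0 < energy_inner B (A *\<^sub>v u) (A *\<^sub>v u)"
    using energy_inner_pos[OF B_spd] spd_mult_nonzero u A by auto
  also have "\<dots> = a * energy_inner A u u"
    using preconditioned_inner[OF u(1) u(1)] u energy_inner_smult_right[OF A] by simp
  finally show ?thesis using energy_inner_pos[OF A_spd u(1,2)] by (simp add: zero_less_mult_iff)
qed

text \<open>The least eigenvalue of \<open>B A\<close> is a possible constant.  Coercivity is what makes the supremum defining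
  the approximation property constant finite.\<close>

lemma preconditioned_coercive:
  obtains c where "0 < c"
    "\<And>v. v \<in> carrier_vec n \<Longrightarrow> c * energy_inner A v v \<le> energy_inner B (A *\<^sub>v v) (A *\<^sub>v v)"
proof -
  \<comment> \<open>The inserted \<open>1\<close> keeps the set nonempty in dimension \<open>0\<close>.\<close>
  define c where "c = Min (insert 1 (Collect (eigenvalue (B * A))))"
  have fin: "finite (insert 1 (Collect (eigenvalue (B * A))))"
    using card_finite_spectrum(1)[OF BA] by (simp add: spectrum_def)
  have "0 < c" unfolding c_def using fin preconditioned_eigenvalue_pos by simp
  moreover have "c * energy_inner A v v \<le> energy_inner B (A *\<^sub>v v) (A *\<^sub>v v)"
    if v: "v \<in> carrier_vec n" for v
  proof -
    have "poly [:c:] a \<le> poly [:- 0, 1:] a" if "eigenvalue (B * A) a" for a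
      unfolding c_def using fin that by simp
    from poly_act_mono[OF A_spd BA preconditioned_self_adjoint v this]
    have "energy_inner A v (poly_act (B * A) [:c:] v)
        \<le> energy_inner A v (poly_act (B * A) [:- 0, 1:] v)" .
    moreover have "poly_act (B * A) [:c:] v = c \<cdot>\<^sub>v v"
      using v BA by (simp add: poly_act_pCons[OF BA] poly_act_0[OF BA])
    moreover have "poly_act (B * A) [:- 0, 1:] v = (B * A) *\<^sub>v v"
      unfolding poly_act_linear[OF BA v] using v BA by (intro eq_vecI) auto
    ultimately show ?thesis
      using v preconditioned_inner[OF v v] energy_inner_smult_right[OF A v v] by simp
  qed
  ultimately show ?thesis using that by blast
qed

lemma preconditioned_eigenvalue_le_1:
  assumes rho: "real_spectral_radius (B * A) \<le> 1" and a: "eigenvalue (B * A) a"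
  shows "a \<le> 1"
proof -
  have n: "0 < n" using eigenvalue_imp_nonzero_dim[OF BA a] .
  have "eigenvalue (map_mat complex_of_real (B * A)) (complex_of_real a)"
    using of_real_hom.eigenvalue_hom[OF BA a] .
  hence "norm (complex_of_real a) \<in> norm ` spectrum (map_mat complex_of_real (B * A))"
    unfolding spectrum_def by blast
  hence "norm (complex_of_real a) \<le> spectral_radius (map_mat complex_of_real (B * A))"
    using spectral_radius_mem_max(2)[of "map_mat complex_of_real (B * A)" n] BA n by auto
  thus ?thesis using rho by (simp add: real_spectral_radius_def)
qed

text \<open>Both sides are quadratic forms of polynomials in \<open>B A\<close> at \<open>u\<close>: the left one of \<open>k p x p\<close>, the
  right one of \<open>d (1 - p\<^sup>2)\<close>.  On the spectrum, which lies in the interval from \<open>0\<close> to \<open>1\<close>, they are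
  ordered by assumption.\<close>

lemma polynomial_smoothing:
  assumes rho: "real_spectral_radius (B * A) \<le> 1"
    and le: "\<And>x. 0 < x \<Longrightarrow> x \<le> 1 \<Longrightarrow> k * (x * (poly p x)\<^sup>2) \<le> d * (1 - (poly p x)\<^sup>2)"
    and u: "u \<in> carrier_vec n"
  defines "s \<equiv> poly_act (B * A) p u"
  shows "k * energy_inner B (A *\<^sub>v s) (A *\<^sub>v s) \<le> d * (energy_inner A u u - energy_inner A s s)"
proof -
  let ?X = "B * A"
  note [simp] = poly_act_carrier[OF BA]
  have self_adjoint: "energy_inner A (poly_act ?X q v) w = energy_inner A v (poly_act ?X q w)"
    if "v \<in> carrier_vec n" "w \<in> carrier_vec n" for q v w
    using poly_act_self_adjoint[OF A_spd BA] preconditioned_self_adjoint that by blast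
  have s: "s \<in> carrier_vec n" unfolding s_def using u by simp
  define f where "f = Polynomial.smult k (p * ([:- 0, 1:] * p))"
  define g where "g = Polynomial.smult d (1 + Polynomial.smult (-1) (p * p))"
  have "poly f a \<le> poly g a" if "eigenvalue ?X a" for a
    using le[OF preconditioned_eigenvalue_pos[OF that] preconditioned_eigenvalue_le_1[OF rho that]]
    by (simp add: f_def g_def power2_eq_square mult_ac)
  from poly_act_mono[OF A_spd BA preconditioned_self_adjoint u this]
  have "energy_inner A u (poly_act ?X f u) \<le> energy_inner A u (poly_act ?X g u)" .
  moreover have "poly_act ?X [:- 0, 1:] s = ?X *\<^sub>v s"
    unfolding poly_act_linear[OF BA s] using s BA by (intro eq_vecI) auto
  hence "energy_inner A u (poly_act ?X f u) = k * energy_inner B (A *\<^sub>v s) (A *\<^sub>v s)"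
    using u s preconditioned_inner[OF s s] self_adjoint[OF u, of "?X *\<^sub>v s" p] BA
    by (simp only: f_def poly_act_smult[OF BA] poly_act_mult[OF BA] s_def[symmetric])
      (simp add: energy_inner_smult_right[OF A] s_def[symmetric])
  moreover have "energy_inner A u (poly_act ?X g u) = d * (energy_inner A u u - energy_inner A s s)"
  proof -
    have one: "poly_act ?X 1 u = u"
      using u BA by (simp add: one_pCons poly_act_pCons[OF BA] poly_act_0[OF BA])
    have "energy_inner A u (poly_act ?X p s) = energy_inner A s s"
      using self_adjoint[OF u s, of p] by (simp add: s_def)
    thus ?thesis
      using u s by (simp add: g_def poly_act_smult[OF BA] poly_act_add[OF BA] poly_act_mult[OF BA]
          one energy_inner_smult_right[OF A] energy_inner_add_right[OF A]
          del: smult_minus_left smult_1_left flip: s_def)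
  qed
  ultimately show ?thesis by simp
qed

end

section \<open>Coarse-grid correction\<close>

locale two_level =
  fixes n m :: nat and A Ac P :: "real mat"
  assumes A_spd: "spd n A"
    and P: "P \<in> carrier_mat n m"
    and P_inj: "inj_on (\<lambda>v. P *\<^sub>v v) (carrier_vec m)"
    and Ac_def: "Ac = transpose_mat P * A * P"
begin

lemma A: "A \<in> carrier_mat n n"
  using A_spd by (rule spd_carrier)

lemma PT: "transpose_mat P \<in> carrier_mat m n"
  using P by simp

lemma coarse_mult: "w \<in> carrier_vec m \<Longrightarrow> Ac *\<^sub>v w = transpose_mat P *\<^sub>v (A *\<^sub>v (P *\<^sub>v w))"
  unfolding Ac_def using A P PT by (simp add: assoc_mult_mat_vec[of _ m n _ m])

lemma energy_inner_prolongation: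
  assumes u: "u \<in> carrier_vec m" and w: "w \<in> carrier_vec m"
  shows "energy_inner A (P *\<^sub>v u) (P *\<^sub>v w) = energy_inner Ac u w"
  using energy_inner_adjoint[OF P A u, of "P *\<^sub>v w"] coarse_mult[OF w] P w
  by (simp add: energy_inner_def)

lemma coarse_spd: "spd m Ac"
  unfolding spd_def
proof (intro conjI ballI impI)
  show "Ac \<in> carrier_mat m m" unfolding Ac_def using A P by auto
  have "transpose_mat A = A" using A_spd by (simp add: spd_def)
  thus "transpose_mat Ac = Ac"
    unfolding Ac_def using A P PT
      transpose_mult[OF mult_carrier_mat[OF PT A] P] transpose_mult[OF PT A]
    by (simp only: transpose_transpose) (rule assoc_mult_mat[symmetric, OF PT A P])
  fix v :: "real vec"
  assume v: "v \<in> carrier_vec m" "v \<noteq> 0\<^sub>v m"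
  have "P *\<^sub>v v \<noteq> P *\<^sub>v 0\<^sub>v m" using P_inj v by (auto dest: inj_onD)
  hence "P *\<^sub>v v \<noteq> 0\<^sub>v n" using mult_mat_zero_vec[OF P] by simp
  hence "0 < energy_inner A (P *\<^sub>v v) (P *\<^sub>v v)" using energy_inner_pos[OF A_spd] P v by simp
  hence "0 < energy_inner Ac v v" unfolding energy_inner_prolongation[OF v(1) v(1)] .
  thus "0 < v \<bullet> (Ac *\<^sub>v v)" unfolding energy_inner_def .
qed

lemma Ac: "Ac \<in> carrier_mat m m"
  using coarse_spd by (rule spd_carrier)

text \<open>The energy-orthogonal projection of \<open>v\<close> onto the range of \<open>P\<close> is \<open>P\<close> applied to
  \<open>coarse_coord v\<close>.\<close>

definition coarse_coord :: "real vec \<Rightarrow> real vec" where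
  "coarse_coord v = inv_mat Ac *\<^sub>v (transpose_mat P *\<^sub>v (A *\<^sub>v v))"

definition fine_part :: "real vec \<Rightarrow> real vec" where
  "fine_part v = v - P *\<^sub>v coarse_coord v"

lemma coarse_coord_carrier [simp]: "v \<in> carrier_vec n \<Longrightarrow> coarse_coord v \<in> carrier_vec m"
  unfolding coarse_coord_def using inv_mat_spd(1)[OF coarse_spd] PT A by simp

lemma fine_part_carrier [simp]: "v \<in> carrier_vec n \<Longrightarrow> fine_part v \<in> carrier_vec n"
  unfolding fine_part_def using P by simp

lemma coarse_mult_coord:
  assumes "v \<in> carrier_vec n"
  shows "Ac *\<^sub>v coarse_coord v = transpose_mat P *\<^sub>v (A *\<^sub>v v)"
proof -
  have w: "transpose_mat P *\<^sub>v (A *\<^sub>v v) \<in> carrier_vec m" using PT A assms by simp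
  have "Ac *\<^sub>v coarse_coord v = (Ac * inv_mat Ac) *\<^sub>v (transpose_mat P *\<^sub>v (A *\<^sub>v v))"
    unfolding coarse_coord_def using Ac inv_mat_spd(1)[OF coarse_spd] w
    by (simp add: assoc_mult_mat_vec[of _ m m _ m])
  thus ?thesis using inv_mat_spd(2)[OF coarse_spd] w by simp
qed

lemma fine_plus_coarse: "v \<in> carrier_vec n \<Longrightarrow> v = fine_part v + P *\<^sub>v coarse_coord v"
  unfolding fine_part_def using P by (intro eq_vecI) auto

lemma fine_part_orthogonal:
  assumes v: "v \<in> carrier_vec n" and w: "w \<in> carrier_vec m"
  shows "energy_inner A (P *\<^sub>v w) (fine_part v) = 0"
proof -
  have "transpose_mat P *\<^sub>v (A *\<^sub>v fine_part v) = transpose_mat P *\<^sub>v (A *\<^sub>v v) - Ac *\<^sub>v coarse_coord v"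
    unfolding fine_part_def using v A P PT
    by (simp add: mult_minus_distrib_mat_vec[of _ n n] mult_minus_distrib_mat_vec[of _ m n]
        coarse_mult)
  also have "\<dots> = 0\<^sub>v m" using v A PT by (simp add: coarse_mult_coord minus_cancel_vec[of _ m])
  finally show ?thesis
    using energy_inner_adjoint[OF P A w fine_part_carrier[OF v]] w by simp
qed

lemma energy_inner_split:
  assumes v: "v \<in> carrier_vec n" and s: "s \<in> carrier_vec n"
    and a: "a \<in> carrier_vec m" and b: "b \<in> carrier_vec m"
  shows "energy_inner A (fine_part v + P *\<^sub>v a) (fine_part s + P *\<^sub>v b)
    = energy_inner A (fine_part v) (fine_part s) + energy_inner Ac a b"
proof -
  have "P *\<^sub>v a \<in> carrier_vec n" "P *\<^sub>v b \<in> carrier_vec n" using P a b by auto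
  thus ?thesis
    using v s a b fine_part_orthogonal[OF s a] fine_part_orthogonal[OF v b]
      energy_inner_commute[OF A_spd, of "fine_part v" "P *\<^sub>v b"]
    by (simp add: energy_inner_add_left[OF A] energy_inner_add_right[OF A]
        energy_inner_prolongation)
qed

lemma energy_inner_Pythagoras:
  assumes v: "v \<in> carrier_vec n"
  shows "energy_inner A v v = energy_inner A (fine_part v) (fine_part v)
    + energy_inner Ac (coarse_coord v) (coarse_coord v)"
  using energy_inner_split[OF v v coarse_coord_carrier[OF v] coarse_coord_carrier[OF v]]
    fine_plus_coarse[OF v] by simp

lemma approximation_operator_carrier:
  "inv_mat A - P * inv_mat Ac * transpose_mat P \<in> carrier_mat n n"
  using P inv_mat_spd(1)[OF coarse_spd] by (intro minus_carrier_mat) auto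

text \<open>The substitution \<open>f = A v\<close> turns the operator in the approximation property into the projector
  onto the orthogonal complement of the coarse space.\<close>

lemma approximation_operator:
  assumes v: "v \<in> carrier_vec n"
  shows "(inv_mat A - P * inv_mat Ac * transpose_mat P) *\<^sub>v (A *\<^sub>v v) = fine_part v"
proof -
  note invs = inv_mat_spd[OF A_spd] inv_mat_spd(1)[OF coarse_spd]
  have Av: "A *\<^sub>v v \<in> carrier_vec n" using A v by simp
  have "inv_mat A *\<^sub>v (A *\<^sub>v v) = (inv_mat A * A) *\<^sub>v v"
    by (rule assoc_mult_mat_vec[symmetric, OF invs(1) A v])
  also have "\<dots> = v" using invs(3) v by simp
  finally have 1: "inv_mat A *\<^sub>v (A *\<^sub>v v) = v" .
  have PI: "P * inv_mat Ac \<in> carrier_mat n m" using P invs by auto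
  have 2: "(P * inv_mat Ac * transpose_mat P) *\<^sub>v (A *\<^sub>v v) = P *\<^sub>v coarse_coord v"
    unfolding coarse_coord_def assoc_mult_mat_vec[OF PI PT Av]
    by (rule assoc_mult_mat_vec[OF P invs(4) mult_mat_vec_carrier[OF PT Av]])
  show ?thesis
    unfolding fine_part_def using 1 2 P PT PI invs Av
    by (subst minus_mult_distrib_mat_vec[of _ n n]) auto
qed

context
  fixes B :: "real mat"
  assumes B_spd: "spd n B"
begin

text \<open>By homogeneity it suffices to treat \<open>f = A v\<close> of unit norm.  The supremum is one of real numbers, so
  it bounds its members only because the set is bounded: the complementary projection does not
  increase the energy norm, which coercivity of \<open>B A\<close> controls by the norm of \<open>f\<close>.\<close>

lemma approximation_property:
  assumes v: "v \<in> carrier_vec n"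
  shows "energy_inner A (fine_part v) (fine_part v)
    \<le> approx_const A Ac P B * energy_inner B (A *\<^sub>v v) (A *\<^sub>v v)"
proof (cases "v = 0\<^sub>v n")
  case True
  have "fine_part v = 0\<^sub>v n"
    using approximation_operator[OF v] mult_mat_zero_vec[OF A]
      mult_mat_zero_vec[OF approximation_operator_carrier] by (simp add: True)
  thus ?thesis using True mult_mat_zero_vec[OF A]
      energy_inner_zero_right[OF spd_carrier[OF B_spd] zero_carrier_vec]
      energy_inner_zero_right[OF A zero_carrier_vec] by simp
next
  case False
  let ?T = "inv_mat A - P * inv_mat Ac * transpose_mat P"
  let ?F = "{f \<in> carrier_vec (dim_row A). energy_norm B f \<le> 1}"
  obtain c where c: "0 < c"
    "\<And>v. v \<in> carrier_vec n \<Longrightarrow> c * energy_inner A v v \<le> energy_inner B (A *\<^sub>v v) (A *\<^sub>v v)"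
    using preconditioned_coercive[OF A_spd B_spd] by blast
  have bdd: "bdd_above ((\<lambda>f. (energy_norm A (?T *\<^sub>v f))\<^sup>2) ` ?F)"
  proof (rule bdd_aboveI2)
    fix f assume "f \<in> ?F"
    hence f: "f \<in> carrier_vec n" and f1: "energy_norm B f \<le> 1" using A by auto
    define w where "w = inv_mat A *\<^sub>v f"
    have w: "w \<in> carrier_vec n" unfolding w_def using inv_mat_spd(1)[OF A_spd] f by simp
    have "A *\<^sub>v w = (A * inv_mat A) *\<^sub>v f"
      unfolding w_def using A inv_mat_spd(1)[OF A_spd] f by (simp add: assoc_mult_mat_vec[of _ n n _ n])
    hence Aw: "A *\<^sub>v w = f" using inv_mat_spd(2)[OF A_spd] f by simp
    have "(energy_norm A (?T *\<^sub>v f))\<^sup>2 = energy_inner A (fine_part w) (fine_part w)"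
      using approximation_operator[OF w] w energy_norm_sq[OF A_spd] by (simp add: Aw)
    also have "\<dots> \<le> energy_inner A w w"
      using energy_inner_Pythagoras[OF w] energy_inner_nonneg[OF coarse_spd] w by simp
    also have "\<dots> \<le> energy_inner B f f / c"
      using c(2)[OF w] c(1) by (simp add: Aw field_simps)
    also have "energy_inner B f f \<le> 1"
      using f1 energy_norm_sq[OF B_spd f] energy_inner_nonneg[OF B_spd f]
      by (simp add: energy_norm_def energy_inner_def)
    finally show "(energy_norm A (?T *\<^sub>v f))\<^sup>2 \<le> 1 / c" using c(1) by (simp add: divide_right_mono)
  qed
  define f where "f = A *\<^sub>v v"
  have f: "f \<in> carrier_vec n" unfolding f_def using A v by simp
  have "f \<noteq> 0\<^sub>v n" unfolding f_def using spd_mult_nonzero[OF A_spd B_spd v False] .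
  hence pos: "0 < energy_inner B f f" using energy_inner_pos[OF B_spd f] by blast
  define t where "t = 1 / sqrt (energy_inner B f f)"
  have t: "0 < t" "t\<^sup>2 * energy_inner B f f = 1"
    using pos by (auto simp: t_def power_divide)
  have tf: "t \<cdot>\<^sub>v f \<in> carrier_vec n" using f by simp
  have "energy_inner B (t \<cdot>\<^sub>v f) (t \<cdot>\<^sub>v f) = 1"
    using f t(2) by (simp add: energy_inner_smult_left[OF spd_carrier[OF B_spd]]
        energy_inner_smult_right[OF spd_carrier[OF B_spd]] power2_eq_square)
  hence "t \<cdot>\<^sub>v f \<in> ?F" using tf A by (auto simp: energy_norm_def energy_inner_def)
  from cSUP_upper[OF this bdd]
  have "(energy_norm A (?T *\<^sub>v (t \<cdot>\<^sub>v f)))\<^sup>2 \<le> approx_const A Ac P B"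
    unfolding approx_const_def .
  moreover have "?T *\<^sub>v (t \<cdot>\<^sub>v f) = t \<cdot>\<^sub>v fine_part v"
    using mult_mat_vec[OF approximation_operator_carrier f] approximation_operator[OF v]
    by (simp add: f_def)
  moreover have "(energy_norm A (t \<cdot>\<^sub>v fine_part v))\<^sup>2 = t\<^sup>2 * energy_inner A (fine_part v) (fine_part v)"
    using v by (subst energy_norm_sq[OF A_spd])
      (auto simp: energy_inner_smult_left[OF A] energy_inner_smult_right[OF A] power2_eq_square)
  ultimately have "t\<^sup>2 * energy_inner A (fine_part v) (fine_part v) \<le> approx_const A Ac P B"
    by simp
  from mult_right_mono[OF this less_imp_le[OF pos]]
  have "(t\<^sup>2 * energy_inner B f f) * energy_inner A (fine_part v) (fine_part v)
      \<le> approx_const A Ac P B * energy_inner B f f"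
    by (simp only: mult_ac)
  thus ?thesis unfolding t(2) by (simp add: f_def)
qed

text \<open>The coarse space is a proper subspace, so some \<open>f \<noteq> 0\<close> has \<open>P\<^sup>T f = 0\<close>, and its preimage under \<open>A\<close>
  is orthogonal to the coarse space.  Strict positivity matters when \<open>\<gamma> = \<infinity>\<close>: the quotient in the
  bound is then \<open>1\<close> and not \<open>0 / 0\<close>.\<close>

lemma approx_const_pos:
  assumes "m < n"
  shows "0 < approx_const A Ac P B"
proof -
  obtain f where f: "f \<in> carrier_vec n" "f \<noteq> 0\<^sub>v n" "transpose_mat P *\<^sub>v f = 0\<^sub>v m"
    using wide_matrix_kernel[OF PT assms] by blast
  define v where "v = inv_mat A *\<^sub>v f"
  have v: "v \<in> carrier_vec n" unfolding v_def using inv_mat_spd(1)[OF A_spd] f by simp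
  have "A *\<^sub>v v = (A * inv_mat A) *\<^sub>v f"
    unfolding v_def using A inv_mat_spd(1)[OF A_spd] f by (simp add: assoc_mult_mat_vec[of _ n n _ n])
  hence Av: "A *\<^sub>v v = f" using inv_mat_spd(2)[OF A_spd] f by simp
  have "coarse_coord v = 0\<^sub>v m"
    unfolding coarse_coord_def Av f(3) using mult_mat_zero_vec[OF inv_mat_spd(1)[OF coarse_spd]] .
  hence "fine_part v = v" unfolding fine_part_def using mult_mat_zero_vec[OF P] v by simp
  moreover have "v \<noteq> 0\<^sub>v n" using Av f(2) mult_mat_zero_vec[OF A] by auto
  ultimately have "0 < energy_inner A (fine_part v) (fine_part v)"
    using energy_inner_pos[OF A_spd v] by simp
  also have "\<dots> \<le> approx_const A Ac P B * energy_inner B f f"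
    using approximation_property[OF v] by (simp add: Av)
  finally show ?thesis
    using energy_inner_nonneg[OF B_spd f(1)] by (simp add: zero_less_mult_iff)
qed

end

end

section \<open>One level of the half V-cycle\<close>

text \<open>Here \<open>x\<close> and \<open>y\<close> are inner products in the two summands of an orthogonal sum, and \<open>d\<close> weights the
  second one.  The mixed term \<open>2 x y\<close> is bounded by the arithmetic-geometric mean inequality.\<close>

lemma Cauchy_Schwarz_direct_sum:
  fixes x y a b c e d :: real
  assumes x: "x\<^sup>2 \<le> a * b" and y: "y\<^sup>2 \<le> d * c * e"
    and nn: "0 \<le> a" "0 \<le> b" "0 \<le> c" "0 \<le> e" "0 \<le> d"
  shows "(x + y)\<^sup>2 \<le> (a + c) * (b + d * e)"
proof -
  have "(x * y)\<^sup>2 \<le> (a * b) * (d * c * e)"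
    unfolding power_mult_distrib using x y nn by (intro mult_mono) auto
  also have "4 * \<dots> \<le> (a * (d * e) + c * b)\<^sup>2"
    using zero_le_power2[of "a * (d * e) - c * b"] by (simp add: power2_eq_square algebra_simps)
  finally have sq: "(2 * (x * y))\<^sup>2 \<le> (a * (d * e) + c * b)\<^sup>2" by (simp add: power_mult_distrib)
  have "0 \<le> a * (d * e) + c * b" using nn by simp
  with sq have "2 * (x * y) \<le> a * (d * e) + c * b" by (rule power2_le_imp_le)
  moreover have "(x + y)\<^sup>2 = x\<^sup>2 + y\<^sup>2 + 2 * (x * y)" by (simp add: power2_sum)
  moreover have "(a + c) * (b + d * e) = a * b + d * c * e + (a * (d * e) + c * b)"
    by (simp add: algebra_simps)
  ultimately show ?thesis using x y by linarith
qed

text \<open>Testing \<open>u = G k\<close> against itself and moving \<open>G\<close> to the other side replaces the estimate of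
  \<open>\<parallel>G K v\<parallel>\<close> by one of \<open>\<langle>k, s\<rangle>\<close> with \<open>s = G u\<close>, so the smoother acts on the vector whose component off
  the coarse space has to be controlled.  One then divides by \<open>\<parallel>u\<parallel>\<^sup>2\<close>.\<close>

lemma (in two_level) vcycle_level:
  assumes B_spd: "spd n B"
    and rho: "real_spectral_radius (B * A) \<le> 1"
    and M: "M \<in> carrier_mat m m"
    and coarse: "\<And>w. w \<in> carrier_vec m \<Longrightarrow>
      energy_inner Ac ((1\<^sub>m m - M * Ac) *\<^sub>v w) ((1\<^sub>m m - M * Ac) *\<^sub>v w) \<le> d * energy_inner Ac w w"
    and d: "0 \<le> d" "d \<le> 1"
    and smoothing: "\<And>x. 0 < x \<Longrightarrow> x \<le> 1 \<Longrightarrow>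
      (1 - d) * approx_const A Ac P B * (x * (poly p x)\<^sup>2) \<le> d * (1 - (poly p x)\<^sup>2)"
    and v: "v \<in> carrier_vec n"
  defines "E \<equiv> poly_mat p (B * A) * (1\<^sub>m n - P * M * transpose_mat P * A)"
  shows "energy_inner A (E *\<^sub>v v) (E *\<^sub>v v) \<le> d * energy_inner A v v"
proof -
  let ?C = "approx_const A Ac P B"
  note B = spd_carrier[OF B_spd]
  have BA: "B * A \<in> carrier_mat n n" using A B by auto
  note coarse_nn = energy_inner_nonneg[OF coarse_spd] and fine_nn = energy_inner_nonneg[OF A_spd]
  define k where "k = (1\<^sub>m n - P * M * transpose_mat P * A) *\<^sub>v v"
  define u where "u = E *\<^sub>v v"
  define a where "a = coarse_coord v"
  define e where "e = (1\<^sub>m m - M * Ac) *\<^sub>v a"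
  have PM: "P * M \<in> carrier_mat n m" using P M by auto
  have PMPT: "P * M * transpose_mat P \<in> carrier_mat n n" using PM PT by auto
  have K: "1\<^sub>m n - P * M * transpose_mat P * A \<in> carrier_mat n n"
    using PMPT A by (intro minus_carrier_mat) auto
  have MAc: "M * Ac \<in> carrier_mat m m" using M Ac by auto
  have k: "k \<in> carrier_vec n" unfolding k_def using K v by simp
  have a: "a \<in> carrier_vec m" unfolding a_def using v by simp
  have e: "e \<in> carrier_vec m" unfolding e_def
    by (rule mult_mat_vec_carrier[OF minus_carrier_mat[OF MAc] a])
  have u_eq: "u = poly_act (B * A) p k"
    unfolding u_def E_def k_def poly_act_def
    by (rule assoc_mult_mat_vec[OF poly_mat_carrier[OF BA] K v])
  have u: "u \<in> carrier_vec n" unfolding u_eq using poly_act_carrier[OF BA k] .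
  define s where "s = poly_act (B * A) p u"
  have s: "s \<in> carrier_vec n" unfolding s_def using poly_act_carrier[OF BA u] .
  define b where "b = coarse_coord s"
  have b: "b \<in> carrier_vec m" unfolding b_def using s by simp

  \<comment> \<open>The correction leaves the fine part alone and applies the coarse error propagation to the coordinates.\<close>
  have k_split: "k = fine_part v + P *\<^sub>v e"
  proof -
    have PTA: "transpose_mat P *\<^sub>v (A *\<^sub>v v) \<in> carrier_vec m" using PT A v by simp
    have Av: "A *\<^sub>v v \<in> carrier_vec n" using A v by simp
    have "(P * M * transpose_mat P * A) *\<^sub>v v = P *\<^sub>v (M *\<^sub>v (Ac *\<^sub>v a))"
      unfolding assoc_mult_mat_vec[OF PMPT A v] assoc_mult_mat_vec[OF PM PT Av]
        assoc_mult_mat_vec[OF P M PTA] a_def coarse_mult_coord[OF v] ..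
    hence "k = v - P *\<^sub>v (M *\<^sub>v (Ac *\<^sub>v a))"
      unfolding k_def using PMPT A v by (subst minus_mult_distrib_mat_vec[of _ n n]) auto
    moreover have "P *\<^sub>v e = P *\<^sub>v a - P *\<^sub>v (M *\<^sub>v (Ac *\<^sub>v a))"
    proof -
      have "e = a - M *\<^sub>v (Ac *\<^sub>v a)"
        unfolding e_def using MAc M Ac a by (subst minus_mult_distrib_mat_vec[of _ m m]) auto
      thus ?thesis using P M Ac a by (simp add: mult_minus_distrib_mat_vec[OF P])
    qed
    ultimately show ?thesis
      unfolding fine_part_def a_def[symmetric] using P v a M Ac by (intro eq_vecI) auto
  qed
  have "energy_inner A (poly_act (B * A) p k) u = energy_inner A k s"
    unfolding s_def
    by (rule poly_act_self_adjoint[OF A_spd BA _ k u]) (rule preconditioned_self_adjoint[OF A_spd B_spd])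
  hence "energy_inner A u u = energy_inner A k s" by (simp flip: u_eq)
  also have "\<dots> = energy_inner A (fine_part v + P *\<^sub>v e) (fine_part s + P *\<^sub>v b)"
    using k_split fine_plus_coarse[OF s] by (simp flip: b_def)
  also have "\<dots> = energy_inner A (fine_part v) (fine_part s) + energy_inner Ac e b"
    using energy_inner_split[OF v s e b] .
  finally have uu: "energy_inner A u u
    = energy_inner A (fine_part v) (fine_part s) + energy_inner Ac e b" .

  have "(energy_inner Ac e b)\<^sup>2 \<le> energy_inner Ac e e * energy_inner Ac b b"
    by (rule energy_Cauchy_Schwarz[OF coarse_spd e b])
  also have "\<dots> \<le> d * energy_inner Ac a a * energy_inner Ac b b"
    using coarse[OF a] coarse_nn[OF b] unfolding e_def by (rule mult_right_mono)
  finally have "(energy_inner A u u)\<^sup>2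
    \<le> (energy_inner A (fine_part v) (fine_part v) + energy_inner Ac a a)
      * (energy_inner A (fine_part s) (fine_part s) + d * energy_inner Ac b b)"
    unfolding uu using d v s a b
    by (intro Cauchy_Schwarz_direct_sum energy_Cauchy_Schwarz[OF A_spd] coarse_nn fine_nn) auto
  also have "energy_inner A (fine_part v) (fine_part v) + energy_inner Ac a a = energy_inner A v v"
    unfolding a_def using energy_inner_Pythagoras[OF v] by simp
  also have "energy_inner A (fine_part s) (fine_part s) + d * energy_inner Ac b b
      \<le> d * energy_inner A u u"
  proof -
    have "(1 - d) * energy_inner A (fine_part s) (fine_part s)
        \<le> (1 - d) * (?C * energy_inner B (A *\<^sub>v s) (A *\<^sub>v s))"
      using approximation_property[OF B_spd s] d by (intro mult_left_mono) auto
    also have "\<dots> \<le> d * (energy_inner A u u - energy_inner A s s)"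
      using polynomial_smoothing[OF A_spd B_spd rho smoothing u] by (simp add: s_def)
    finally show ?thesis
      using energy_inner_Pythagoras[OF s] by (simp add: b_def algebra_simps)
  qed
  finally have "(energy_inner A u u)\<^sup>2 \<le> energy_inner A v v * (d * energy_inner A u u)"
    using fine_nn[OF v] by (simp add: mult_left_mono)
  hence le: "energy_inner A u u * energy_inner A u u \<le> (d * energy_inner A v v) * energy_inner A u u"
    by (simp add: power2_eq_square mult_ac)
  show ?thesis
  proof (cases "energy_inner A u u = 0")
    case True
    thus ?thesis using d fine_nn[OF v] by (simp add: u_def)
  next
    case False
    with fine_nn[OF u] have "0 < energy_inner A u u" by simp
    with le show ?thesis by (simp add: u_def)
  qed
qed

section \<open>The contraction bound of a level\<close>

text \<open>With \<open>t = C / (C + 1 / \<gamma>) = C \<gamma> / (C \<gamma> + 1)\<close> one has \<open>1 - t = 1 / (C \<gamma> + 1)\<close>, so the final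
  inequality is \<open>x p(x)\<^sup>2 \<le> \<gamma> (1 - p(x)\<^sup>2)\<close> rescaled.  For \<open>\<gamma> = \<infinity>\<close> it degenerates to \<open>t = 1\<close> and
  \<open>p(x)\<^sup>2 \<le> 1\<close>.\<close>

lemma contraction_term:
  assumes C: "0 < C" and p0: "poly p 0 = 1"
    and p_less: "\<And>x. 0 < x \<Longrightarrow> x \<le> 1 \<Longrightarrow> \<bar>poly p x\<bar> < 1"
  obtains t :: real where "ereal C / (ereal C + inverse (smoothing_gamma p)) = ereal t"
    "0 \<le> t" "t \<le> 1"
    "\<And>x. 0 < x \<Longrightarrow> x \<le> 1 \<Longrightarrow> (1 - t) * C * (x * (poly p x)\<^sup>2) \<le> t * (1 - (poly p x)\<^sup>2)"
proof -
  have p_sq: "(poly p x)\<^sup>2 < 1" if "0 < x" "x \<le> 1" for x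
    using p_less[OF that] by (simp add: abs_square_less_1)
  have upper: "ereal (x * (poly p x)\<^sup>2 / (1 - (poly p x)\<^sup>2)) \<le> smoothing_gamma p"
    if "0 < x" "x \<le> 1" for x
    unfolding smoothing_gamma_def using that by (intro SUP_upper) auto
  \<comment> \<open>A polynomial vanishing on the whole interval would be \<open>0\<close>, so \<open>\<gamma> > 0\<close>.\<close>
  have "p \<noteq> 0" using p0 by auto
  hence "finite {x. poly p x = 0}" by (rule poly_roots_finite)
  moreover have "infinite {0<..(1::real)}" by simp
  ultimately have "\<not> {0<..1} \<subseteq> {x. poly p x = 0}" using finite_subset by blast
  then obtain x0 where x0: "0 < x0" "x0 \<le> 1" "poly p x0 \<noteq> 0" unfolding subset_eq by force
  have "0 < x0 * (poly p x0)\<^sup>2 / (1 - (poly p x0)\<^sup>2)" using x0 p_sq[of x0] by simp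
  hence pos: "0 < smoothing_gamma p"
    using upper[OF x0(1,2)] by (metis ereal_less(2) less_le_trans)
  show ?thesis
  proof (cases "smoothing_gamma p")
    case PInf
    have "ereal C / (ereal C + inverse (smoothing_gamma p)) = ereal 1"
      using C by (simp add: PInf one_ereal_def)
    thus ?thesis using p_sq by (intro that[of 1]) (auto intro: less_imp_le)
  next
    case MInf
    thus ?thesis using pos by simp
  next
    case (real g)
    with pos have g: "0 < g" by simp
    have Cg: "0 < C * g + 1" using C g by (simp add: add_pos_pos)
    define t where "t = C * g / (C * g + 1)"
    have t1: "1 - t = 1 / (C * g + 1)" unfolding t_def using Cg by (simp add: field_simps)
    have "C / (C + inverse g) = t" unfolding t_def using C g by (simp add: field_simps)
    moreover have "C + inverse g \<noteq> 0" using C g by (simp add: add_pos_pos less_imp_neq[symmetric])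
    ultimately have "ereal C / (ereal C + inverse (smoothing_gamma p)) = ereal t"
      using g by (simp add: real)
    moreover have "0 \<le> t" unfolding t_def using C g by simp
    moreover have "t \<le> 1" unfolding t_def using Cg by simp
    moreover have "(1 - t) * C * (x * (poly p x)\<^sup>2) \<le> t * (1 - (poly p x)\<^sup>2)"
      if x: "0 < x" "x \<le> 1" for x
    proof -
      have "x * (poly p x)\<^sup>2 / (1 - (poly p x)\<^sup>2) \<le> g" using upper[OF x] by (simp add: real)
      hence "x * (poly p x)\<^sup>2 \<le> g * (1 - (poly p x)\<^sup>2)"
        using p_sq[OF x] by (simp add: divide_le_eq)
      hence "C * (x * (poly p x)\<^sup>2) \<le> C * (g * (1 - (poly p x)\<^sup>2))" using C by simp
      hence "C * (x * (poly p x)\<^sup>2) / (C * g + 1) \<le> C * (g * (1 - (poly p x)\<^sup>2)) / (C * g + 1)"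
        using Cg by (intro divide_right_mono) auto
      thus ?thesis unfolding t1 by (simp add: t_def mult.assoc)
    qed
    ultimately show ?thesis by (rule that)
  qed
qed

lemma energy_opnorm_sq_le:
  assumes S: "spd n S" and n: "0 < n" and d: "0 \<le> d"
    and T: "T \<in> carrier_mat n n"
    and le: "\<And>v. v \<in> carrier_vec n \<Longrightarrow>
      energy_inner S (T *\<^sub>v v) (T *\<^sub>v v) \<le> d * energy_inner S v v"
  shows "(energy_opnorm S T)\<^sup>2 \<le> d"
proof -
  let ?V = "carrier_vec n - {0\<^sub>v n} :: real vec set"
  let ?q = "\<lambda>v. energy_norm S (T *\<^sub>v v) / energy_norm S v"
  have eq: "energy_opnorm S T = (SUP v\<in>?V. ?q v)"
    unfolding energy_opnorm_def using spd_carrier[OF S] by auto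
  have "unit_vec n 0 \<in> ?V"
  proof -
    have "unit_vec n 0 $ 0 \<noteq> (0\<^sub>v n :: real vec) $ 0" using n by simp
    thus ?thesis by auto
  qed
  hence ne: "?V \<noteq> {}" by blast
  have q_nn: "0 \<le> ?q v" if "v \<in> ?V" for v
    using that T energy_inner_nonneg[OF S] by (auto simp: energy_norm_def energy_inner_def)
  have q_le: "?q v \<le> sqrt d" if v: "v \<in> ?V" for v
  proof -
    have pos: "0 < energy_inner S v v" using energy_inner_pos[OF S] v by auto
    have "energy_inner S (T *\<^sub>v v) (T *\<^sub>v v) / energy_inner S v v \<le> d"
      using le[of v] v pos by (simp add: divide_le_eq)
    thus ?thesis unfolding energy_norm_def energy_inner_def real_sqrt_divide[symmetric]
      by (rule real_sqrt_le_mono)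
  qed
  have "energy_opnorm S T \<le> sqrt d" unfolding eq using ne q_le by (rule cSUP_least)
  moreover have "0 \<le> energy_opnorm S T"
  proof -
    obtain v where v: "v \<in> ?V" using ne by blast
    have "bdd_above (?q ` ?V)" using q_le by (rule bdd_aboveI2)
    from cSUP_upper[OF v this] q_nn[OF v] show ?thesis unfolding eq by simp
  qed
  ultimately have "(energy_opnorm S T)\<^sup>2 \<le> (sqrt d)\<^sup>2" by (intro power_mono)
  thus ?thesis using d by simp
qed

section \<open>The V-cycle bound\<close>

text \<open>Positive definiteness is assumed on the finest level only, so the induction runs downward.\<close>

lemma multigrid_two_level:
  assumes "multigrid_hierarchy L n A P" "l \<in> {1..L}"
  shows "two_level (n l) (n (l - 1)) (A l) (A (l - 1)) (P l)"
proof -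
  have level: "two_level (n k) (n (k - 1)) (A k) (A (k - 1)) (P k)"
    if "spd (n k) (A k)" "k \<in> {1..L}" for k
    using assms(1) that unfolding multigrid_hierarchy_def two_level_def by blast
  have "l \<le> L" using assms(2) by simp
  hence "spd (n l) (A l)"
  proof (induction l rule: inc_induct)
    case base
    show ?case using assms(1) unfolding multigrid_hierarchy_def by blast
  next
    case (step k)
    thus ?case using two_level.coarse_spd[OF level[of "Suc k"]] by simp
  qed
  thus ?thesis using level assms(2) by blast
qed

theorem lemma3p2:
  fixes L :: nat
    and n :: "nat \<Rightarrow> nat"
    and A P B G M :: "nat \<Rightarrow> real mat"
    and p :: "nat \<Rightarrow> real poly"
  assumes hierarchy: "multigrid_hierarchy L n A P"
    and B_spd: "\<forall>l \<in> {1..L}. spd (n l) (B l)"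
    and B_scaled: "\<forall>l \<in> {1..L}. real_spectral_radius (B l * A l) \<le> 1"
    and p_zero: "\<forall>l \<in> {1..L}. poly (p l) 0 = 1"
    and p_less: "\<forall>l \<in> {1..L}. \<forall>x. 0 < x \<and> x \<le> 1 \<longrightarrow> \<bar>poly (p l) x\<bar> < 1"
    and smoother: "\<forall>l \<in> {1..L}. G l = poly_mat (p l) (B l * A l)"
    and vcycle: "half_vcycle L n A P G M"
  shows "ereal ((energy_opnorm (A L) (1\<^sub>m (n L) - M L * A L))\<^sup>2)
    \<le> (MAX l \<in> {1..L}.
          ereal (approx_const (A l) (A (l - 1)) (P l) (B l))
          / (ereal (approx_const (A l) (A (l - 1)) (P l) (B l)) + inverse (smoothing_gamma (p l))))"
proof -
  define C where "C l = approx_const (A l) (A (l - 1)) (P l) (B l)" for l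
  have L: "1 \<le> L" and dims: "\<And>l. l \<in> {1..L} \<Longrightarrow> n (l - 1) < n l"
    using hierarchy unfolding multigrid_hierarchy_def by auto
  note level = multigrid_two_level[OF hierarchy]
  have "\<exists>t. ereal (C l) / (ereal (C l) + inverse (smoothing_gamma (p l))) = ereal t \<and> 0 \<le> t \<and> t \<le> 1
      \<and> (\<forall>x. 0 < x \<longrightarrow> x \<le> 1 \<longrightarrow>
        (1 - t) * C l * (x * (poly (p l) x)\<^sup>2) \<le> t * (1 - (poly (p l) x)\<^sup>2))"
    if l: "l \<in> {1..L}" for l
  proof -
    have "0 < C l"
      unfolding C_def using two_level.approx_const_pos[OF level[OF l]] B_spd dims l by blast
    moreover have "poly (p l) 0 = 1" using p_zero l by blast
    moreover have "\<And>x. 0 < x \<Longrightarrow> x \<le> 1 \<Longrightarrow> \<bar>poly (p l) x\<bar> < 1" using p_less l by blast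
    ultimately obtain t where
      "ereal (C l) / (ereal (C l) + inverse (smoothing_gamma (p l))) = ereal t" "0 \<le> t" "t \<le> 1"
      "\<And>x. 0 < x \<Longrightarrow> x \<le> 1 \<Longrightarrow>
        (1 - t) * C l * (x * (poly (p l) x)\<^sup>2) \<le> t * (1 - (poly (p l) x)\<^sup>2)"
      by (rule contraction_term) blast+
    thus ?thesis by blast
  qed
  then obtain t where t: "\<And>l. l \<in> {1..L} \<Longrightarrow>
      ereal (C l) / (ereal (C l) + inverse (smoothing_gamma (p l))) = ereal (t l)"
    and t01: "\<And>l. l \<in> {1..L} \<Longrightarrow> 0 \<le> t l \<and> t l \<le> 1"
    and t_smooth: "\<And>l x. l \<in> {1..L} \<Longrightarrow> 0 < x \<Longrightarrow> x \<le> 1 \<Longrightarrow>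
        (1 - t l) * C l * (x * (poly (p l) x)\<^sup>2) \<le> t l * (1 - (poly (p l) x)\<^sup>2)"
    by metis
  define d where "d = Max (t ` {1..L})"
  have t_le: "t l \<le> d" if "l \<in> {1..L}" for l unfolding d_def using that by simp
  have "d \<in> t ` {1..L}" unfolding d_def using L by (intro Max_in) auto
  then obtain l0 where l0: "l0 \<in> {1..L}" "d = t l0" by auto
  have d: "0 \<le> d" "d \<le> 1" using t01[OF l0(1)] l0(2) by auto
  \<comment> \<open>The scalar inequality is monotone in \<open>t\<close>, so every level may use the maximum \<open>d\<close> instead of its own \<open>t\<close>.\<close>
  have d_smooth: "(1 - d) * C l * (x * (poly (p l) x)\<^sup>2) \<le> d * (1 - (poly (p l) x)\<^sup>2)"
    if l: "l \<in> {1..L}" and x: "0 < x" "x \<le> 1" for l x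
  proof -
    have "0 < C l"
      unfolding C_def using two_level.approx_const_pos[OF level[OF l]] B_spd dims l by blast
    moreover have "(poly (p l) x)\<^sup>2 \<le> 1"
      using p_less l x by (intro less_imp_le) (simp add: abs_square_less_1)
    ultimately have "(1 - d) * (C l * (x * (poly (p l) x)\<^sup>2))
        \<le> (1 - t l) * (C l * (x * (poly (p l) x)\<^sup>2))"
      and "t l * (1 - (poly (p l) x)\<^sup>2) \<le> d * (1 - (poly (p l) x)\<^sup>2)"
      using t_le[OF l] x by (intro mult_right_mono; simp)+
    thus ?thesis using t_smooth[OF l x] by (simp add: mult.assoc)
  qed
  have M0: "M 0 = inv_mat (A 0)"
    and M: "\<And>l. l \<in> {1..L} \<Longrightarrow> M l \<in> carrier_mat (n l) (n l)"
    and E: "\<And>l. l \<in> {1..L} \<Longrightarrow> 1\<^sub>m (n l) - M l * A l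
      = G l * (1\<^sub>m (n l) - P l * M (l - 1) * transpose_mat (P l) * A l)"
    using vcycle unfolding half_vcycle_def by auto
  have A0: "spd (n 0) (A 0)" using two_level.coarse_spd[OF level[of 1]] L by simp
  have main: "M l \<in> carrier_mat (n l) (n l) \<and> (\<forall>v \<in> carrier_vec (n l).
      energy_inner (A l) ((1\<^sub>m (n l) - M l * A l) *\<^sub>v v) ((1\<^sub>m (n l) - M l * A l) *\<^sub>v v)
        \<le> d * energy_inner (A l) v v)" if "l \<le> L" for l
    using that
  proof (induction l)
    case 0
    have M0A0: "M 0 * A 0 = 1\<^sub>m (n 0)" "M 0 \<in> carrier_mat (n 0) (n 0)"
      using inv_mat_spd[OF A0] by (simp_all add: M0)
    have "(1\<^sub>m (n 0) - M 0 * A 0) *\<^sub>v v = 0\<^sub>v (n 0)" if "v \<in> carrier_vec (n 0)" for v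
      unfolding M0A0 using that by (intro eq_vecI) (auto simp: minus_mult_distrib_mat_vec[of _ "n 0" "n 0"])
    thus ?case
      using M0A0(2) d(1) energy_inner_nonneg[OF A0]
        energy_inner_zero_right[OF spd_carrier[OF A0] zero_carrier_vec] by simp
  next
    case (Suc k)
    hence l: "Suc k \<in> {1..L}" by simp
    have lev: "two_level (n (Suc k)) (n k) (A (Suc k)) (A k) (P (Suc k))"
      using level[OF l] by simp
    have E_eq: "1\<^sub>m (n (Suc k)) - M (Suc k) * A (Suc k) = poly_mat (p (Suc k)) (B (Suc k) * A (Suc k))
        * (1\<^sub>m (n (Suc k)) - P (Suc k) * M k * transpose_mat (P (Suc k)) * A (Suc k))"
      using E[OF l] bspec[OF smoother l] by simp
    have coarse: "M k \<in> carrier_mat (n k) (n k)" "\<And>w. w \<in> carrier_vec (n k) \<Longrightarrow>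
        energy_inner (A k) ((1\<^sub>m (n k) - M k * A k) *\<^sub>v w) ((1\<^sub>m (n k) - M k * A k) *\<^sub>v w)
          \<le> d * energy_inner (A k) w w"
      using Suc.IH Suc.prems by simp_all
    have smooth: "(1 - d) * approx_const (A (Suc k)) (A k) (P (Suc k)) (B (Suc k))
        * (x * (poly (p (Suc k)) x)\<^sup>2) \<le> d * (1 - (poly (p (Suc k)) x)\<^sup>2)"
      if "0 < x" "x \<le> 1" for x
      using d_smooth[OF l that] by (simp add: C_def)
    have "energy_inner (A (Suc k)) ((1\<^sub>m (n (Suc k)) - M (Suc k) * A (Suc k)) *\<^sub>v v)
        ((1\<^sub>m (n (Suc k)) - M (Suc k) * A (Suc k)) *\<^sub>v v) \<le> d * energy_inner (A (Suc k)) v v"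
      if v: "v \<in> carrier_vec (n (Suc k))" for v
      unfolding E_eq
      by (rule two_level.vcycle_level[OF lev bspec[OF B_spd l] bspec[OF B_scaled l] coarse d smooth v])
    thus ?case using M[OF l] by blast
  qed
  have LL: "L \<in> {1..L}" using L by simp
  have "(energy_opnorm (A L) (1\<^sub>m (n L) - M L * A L))\<^sup>2 \<le> d"
  proof (rule energy_opnorm_sq_le)
    show AL: "spd (n L) (A L)" using hierarchy unfolding multigrid_hierarchy_def by blast
    show "0 < n L" using dims[OF LL] by simp
    show "1\<^sub>m (n L) - M L * A L \<in> carrier_mat (n L) (n L)"
      using M[OF LL] spd_carrier[OF AL] by (intro minus_carrier_mat) auto
  qed (use d main[OF order_refl] in auto)
  hence "ereal ((energy_opnorm (A L) (1\<^sub>m (n L) - M L * A L))\<^sup>2) \<le> ereal (t l0)" using l0 by simp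
  also have "\<dots> = ereal (C l0) / (ereal (C l0) + inverse (smoothing_gamma (p l0)))"
    using t[OF l0(1)] by simp
  also have "\<dots> \<le> (MAX l \<in> {1..L}. ereal (C l) / (ereal (C l) + inverse (smoothing_gamma (p l))))"
    using l0(1) by (intro Max_ge) auto
  finally show ?thesis unfolding C_def .
qed

end
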